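(* Fix $\kappa\in\mathbb C\setminus\{0\}$. Then the following minimization problems are equivalent. (i) The problem $\operatorname{arg\,min}_{\varepsilon\in\mathbb F,\ \kappa\in\Sigma(\varepsilon)} L(\varepsilon)$ is equivalent to the minimum-time control of the control system from $-n_\infty$ to $n_\infty$, in the sense that $L_{\min}(\kappa)=T^{\min}_\kappa(-n_\infty,n_\infty)$ and the two families of functions consisting of (a) the restrictions to $(s_-^{\varepsilon},s_+^{\varepsilon})$ of minimizers $\varepsilon(\cdot)$ of the first problem and (b) the restrictions to $(s_-,s_-+T^{\min}_\kappa(-n_\infty,n_\infty))$ of minimum-time controls coincide after the translation carrying $s_-$ to $s_-^{\varepsilon}$. (ii) The odd-mode problem $\operatorname{arg\,min}_{\varepsilon\in\mathbb F^{\mathrm{sym}},\ \kappa\in\Sigma^{\mathrm{odd}}(\varepsilon)}L(\varepsilon)$ (respectively, the even-mode problem $\operatorname{arg\,min}_{\varepsilon\in\mathbb F^{\mathrm{sym}},\ \kappa\in\Sigma^{\mathrm{even}}(\varepsilon)}L(\varepsilon)$) is equivalent to the minimum-time control of the control system from $\infty$ (respectively, from $0$) to $n_\infty$, in the sense that $L^{\mathrm{odd}}_{\min}(\kappa)=2T^{\min}_\kappa(\infty,n_\infty)$ (respectively, $L^{\mathrm{even}}_{\min}(\kappa)=2T^{\min}_\kappa(0,n_\infty)$), and the minimizers are identified as follows: the restrictions to $(0,s_+^{\varepsilon})$ of the minimizers $\varepsilon(\cdot)\in\mathbb F^{\mathrm{sym}}$ are, up to the translation carrying $s_-$ to $0$,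 exactly the restrictions of the minimum-time controls to $(s_-,s_-+T)$, where $T$ is the corresponding minimum time.
   Context: Fix constants $0<n_1<n_2$ and $n_\infty>0$; $\hat{\mathbb C}=\mathbb C\cup\{\infty\}$; $\inf\varnothing=+\infty$. Coefficients. $\mathbb F$ is the family of positive $\varepsilon\in L^\infty(\mathbb R;\mathbb R)$ for which there exist real $s_-\le s_+$ with $\varepsilon(s)=n_\infty^2$ for a.a. $s\in\mathbb R\setminus[s_-,s_+]$ and $n_1^2\le\varepsilon(s)\le n_2^2$ for a.a. $s\in(s_-,s_+)$. $\mathbb F^{\mathrm{sym}}=\{\varepsilon\in\mathbb F:\varepsilon(s)=\varepsilon(-s)\text{ a.e.}\}$. If $\varepsilon$ is not the constant $n_\infty^2$, $[s_-^\varepsilon,s_+^\varepsilon]$ is the shortest interval outside of which $\varepsilon=n_\infty^2$ a.e., and $L(\varepsilon)=s_+^\varepsilon-s_-^\varepsilon$; if $\varepsilon\equiv n_\infty^2$, then $s_\pm^\varepsilon=0$ and $L(\varepsilon)=0$. Resonances. $\Sigma(\varepsilon)$ is the set of $\kappa\in\mathbb C\setminus\{0\}$ for which there is a nontrivial $y\in W^{2,\infty}_{\mathrm{loc}}(\mathbb R)$ (a mode) with $y''=-\kappa^2\varepsilon y$ a.e. on $\mathbb R$ and $y'(s_\pm)/\kappa=\pm \mathrm i n_\infty y(s_\pm)$, where $\varepsilon=n_\infty^2$ a.e. outside $[s_-,s_+]$. For $\varepsilon\in\mathbb F^{\mathrm{sym}}$, $\Sigma^{\mathrm{odd}}(\varepsilon)$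 (resp. $\Sigma^{\mathrm{even}}(\varepsilon)$) is the set of $\kappa\in\Sigma(\varepsilon)$ whose mode is an odd (resp. even) function. Put $L_{\min}(\kappa)=\inf\{L(\varepsilon):\varepsilon\in\mathbb F,\kappa\in\Sigma(\varepsilon)\}$ and $L^{\mathrm{odd(even)}}_{\min}(\kappa)=\inf\{L(\varepsilon):\varepsilon\in\mathbb F^{\mathrm{sym}},\kappa\in\Sigma^{\mathrm{odd(even)}}(\varepsilon)\}$. Control system. For $s_-\in\mathbb R$ the feasible controls are $\varepsilon\in L^\infty((s_-,\infty);\mathbb R)$ with $n_1^2\le\varepsilon\le n_2^2$ a.e. The state $x(s)\in\hat{\mathbb C}$ evolves by $x'=\mathrm i\kappa(-x^2+\varepsilon)$ in the chart $\mathbb C$ and, near $\infty$, by $\tilde x'=\mathrm i\kappa(-1+\varepsilon\tilde x^2)$ for $\tilde x=-1/x$. $T^{\min}_\kappa(\eta_-,\eta_+)\in[0,+\infty]$ is the infimum of $t\ge0$ such that some feasible control steers $x(s_-)=\eta_-$ to $x(s_-+t)=\eta_+$ (it does not depend on $s_-$); a feasible control achieving this in time $T^{\min}_\kappa(\eta_-,\eta_+)<\infty$ is called a minimum-time control from $\eta_-$ to $\eta_+$. *)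

theory Defs
  imports "HOL-Analysis.Analysis"
begin

text \<open>
  The constants \<open>0 < n\<^sub>1 < n\<^sub>2\<close> and \<open>n\<^sub>\<infinity> > 0\<close> appear as the parameters \<open>n1\<close>, \<open>n2\<close>, \<open>ninf\<close>.
  Elements of \<open>L\<^sup>\<infinity>\<close> are handled through representatives; every condition imposed on
  them is invariant under changes on Lebesgue null sets.
\<close>

definition Linf_on :: "real set \<Rightarrow> (real \<Rightarrow> 'a::euclidean_space) \<Rightarrow> bool" where
  "Linf_on S f \<longleftrightarrow> f \<in> borel_measurable (lebesgue_on S) \<and>
     (\<exists>C. AE s\<in>S in lebesgue. norm (f s) \<le> C)"

text \<open>
  \<open>is_primitive S F f\<close>: on every compact interval in \<open>S\<close>, \<open>F\<close> is an indefinite integral of \<open>f\<close>.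
  Wherever this is used below, \<open>f\<close> is locally essentially bounded and measurable, so that it says
  that \<open>F\<close> is locally Lipschitz with \<open>F' = f\<close> a.e.
\<close>

definition is_primitive :: "real set \<Rightarrow> (real \<Rightarrow> complex) \<Rightarrow> (real \<Rightarrow> complex) \<Rightarrow> bool" where
  "is_primitive S F f \<longleftrightarrow>
     (\<forall>c d. c \<le> d \<and> {c..d} \<subseteq> S \<longrightarrow> (f has_integral (F d - F c)) {c..d})"

text \<open>
  The function \<open>y\<close> is (the continuously differentiable representative of) an element of
  \<open>W\<^sup>2\<^sup>,\<^sup>\<infinity>\<close>-loc of the real line; \<open>y1\<close> is its derivative, and \<open>y2\<close> is a
  representative of its second weak derivative.
\<close>

definition W2inf_loc :: "(real \<Rightarrow> complex) \<Rightarrow> (real \<Rightarrow> complex) \<Rightarrow> (real \<Rightarrow> complex) \<Rightarrow> bool" where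
  "W2inf_loc y y1 y2 \<longleftrightarrow>
     (\<forall>s. (y has_vector_derivative y1 s) (at s)) \<and>
     is_primitive UNIV y1 y2 \<and> (\<forall>a b. Linf_on {a..b} y2)"


section \<open>Coefficients\<close>

definition const_outside :: "real \<Rightarrow> (real \<Rightarrow> real) \<Rightarrow> real \<Rightarrow> real \<Rightarrow> bool" where
  "const_outside ninf \<epsilon> a b \<longleftrightarrow> a \<le> b \<and> (AE s\<in>- {a..b} in lebesgue. \<epsilon> s = ninf\<^sup>2)"

definition coeffs :: "real \<Rightarrow> real \<Rightarrow> real \<Rightarrow> (real \<Rightarrow> real) set" where
  "coeffs n1 n2 ninf = {\<epsilon>. Linf_on UNIV \<epsilon> \<and> (AE s in lebesgue. \<epsilon> s > 0) \<and>
     (\<exists>a b. const_outside ninf \<epsilon> a b \<and>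
            (AE s\<in>{a<..<b} in lebesgue. n1\<^sup>2 \<le> \<epsilon> s \<and> \<epsilon> s \<le> n2\<^sup>2))}"

definition coeffs_sym :: "real \<Rightarrow> real \<Rightarrow> real \<Rightarrow> (real \<Rightarrow> real) set" where
  "coeffs_sym n1 n2 ninf = {\<epsilon> \<in> coeffs n1 n2 ninf. AE s in lebesgue. \<epsilon> s = \<epsilon> (- s)}"

definition shortest_interval :: "real \<Rightarrow> (real \<Rightarrow> real) \<Rightarrow> real \<times> real" where
  "shortest_interval ninf \<epsilon> =
     (if AE s in lebesgue. \<epsilon> s = ninf\<^sup>2 then (0, 0)
      else THE (a, b). const_outside ninf \<epsilon> a b \<and>
             (\<forall>a' b'. const_outside ninf \<epsilon> a' b' \<longrightarrow> b - a \<le> b' - a'))"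

definition s_minus :: "real \<Rightarrow> (real \<Rightarrow> real) \<Rightarrow> real" where
  "s_minus ninf \<epsilon> = fst (shortest_interval ninf \<epsilon>)"

definition s_plus :: "real \<Rightarrow> (real \<Rightarrow> real) \<Rightarrow> real" where
  "s_plus ninf \<epsilon> = snd (shortest_interval ninf \<epsilon>)"

definition len :: "real \<Rightarrow> (real \<Rightarrow> real) \<Rightarrow> real" where
  "len ninf \<epsilon> = s_plus ninf \<epsilon> - s_minus ninf \<epsilon>"


section \<open>Resonances\<close>

text \<open>
  The choice of the interval \<open>[a, b]\<close> outside of which \<open>\<epsilon>\<close> is constant is immaterial: the
  boundary conditions propagate through regions where \<open>\<epsilon> = n\<^sub>\<infinity>\<^sup>2\<close>.
\<close>

definition is_mode :: "real \<Rightarrow> (real \<Rightarrow> real) \<Rightarrow> complex \<Rightarrow> (real \<Rightarrow> complex) \<Rightarrow> bool" where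
  "is_mode ninf \<epsilon> \<kappa> y \<longleftrightarrow> (\<exists>s. y s \<noteq> 0) \<and>
     (\<exists>y1 y2. W2inf_loc y y1 y2 \<and>
        (AE s in lebesgue. y2 s = - \<kappa>\<^sup>2 * of_real (\<epsilon> s) * y s) \<and>
        (\<exists>a b. const_outside ninf \<epsilon> a b \<and>
           y1 a / \<kappa> = - \<i> * of_real ninf * y a \<and>
           y1 b / \<kappa> = \<i> * of_real ninf * y b))"

definition resonances :: "real \<Rightarrow> (real \<Rightarrow> real) \<Rightarrow> complex set" where
  "resonances ninf \<epsilon> = {\<kappa>. \<kappa> \<noteq> 0 \<and> (\<exists>y. is_mode ninf \<epsilon> \<kappa> y)}"

definition resonances_odd :: "real \<Rightarrow> (real \<Rightarrow> real) \<Rightarrow> complex set" where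
  "resonances_odd ninf \<epsilon> =
     {\<kappa>. \<kappa> \<noteq> 0 \<and> (\<exists>y. is_mode ninf \<epsilon> \<kappa> y \<and> (\<forall>s. y (- s) = - y s))}"

definition resonances_even :: "real \<Rightarrow> (real \<Rightarrow> real) \<Rightarrow> complex set" where
  "resonances_even ninf \<epsilon> =
     {\<kappa>. \<kappa> \<noteq> 0 \<and> (\<exists>y. is_mode ninf \<epsilon> \<kappa> y \<and> (\<forall>s. y (- s) = y s))}"

text \<open>The infimum is taken in \<^typ>\<open>ereal\<close>, where the infimum of the empty set is \<open>\<infinity>\<close>.\<close>

definition L_min :: "real \<Rightarrow> real \<Rightarrow> real \<Rightarrow> complex \<Rightarrow> ereal" where
  "L_min n1 n2 ninf \<kappa> =
     (INF \<epsilon> \<in> {\<epsilon> \<in> coeffs n1 n2 ninf. \<kappa> \<in> resonances ninf \<epsilon>}. ereal (len ninf \<epsilon>))"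

definition L_min_odd :: "real \<Rightarrow> real \<Rightarrow> real \<Rightarrow> complex \<Rightarrow> ereal" where
  "L_min_odd n1 n2 ninf \<kappa> =
     (INF \<epsilon> \<in> {\<epsilon> \<in> coeffs_sym n1 n2 ninf. \<kappa> \<in> resonances_odd ninf \<epsilon>}. ereal (len ninf \<epsilon>))"

definition L_min_even :: "real \<Rightarrow> real \<Rightarrow> real \<Rightarrow> complex \<Rightarrow> ereal" where
  "L_min_even n1 n2 ninf \<kappa> =
     (INF \<epsilon> \<in> {\<epsilon> \<in> coeffs_sym n1 n2 ninf. \<kappa> \<in> resonances_even ninf \<epsilon>}. ereal (len ninf \<epsilon>))"

definition minimizers :: "real \<Rightarrow> real \<Rightarrow> real \<Rightarrow> complex \<Rightarrow> (real \<Rightarrow> real) set" where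
  "minimizers n1 n2 ninf \<kappa> =
     {\<epsilon>. is_arg_min (len ninf) (\<lambda>\<epsilon>. \<epsilon> \<in> coeffs n1 n2 ninf \<and> \<kappa> \<in> resonances ninf \<epsilon>) \<epsilon>}"

definition minimizers_odd :: "real \<Rightarrow> real \<Rightarrow> real \<Rightarrow> complex \<Rightarrow> (real \<Rightarrow> real) set" where
  "minimizers_odd n1 n2 ninf \<kappa> =
     {\<epsilon>. is_arg_min (len ninf) (\<lambda>\<epsilon>. \<epsilon> \<in> coeffs_sym n1 n2 ninf \<and> \<kappa> \<in> resonances_odd ninf \<epsilon>) \<epsilon>}"

definition minimizers_even :: "real \<Rightarrow> real \<Rightarrow> real \<Rightarrow> complex \<Rightarrow> (real \<Rightarrow> real) set" where
  "minimizers_even n1 n2 ninf \<kappa> =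
     {\<epsilon>. is_arg_min (len ninf) (\<lambda>\<epsilon>. \<epsilon> \<in> coeffs_sym n1 n2 ninf \<and> \<kappa> \<in> resonances_even ninf \<epsilon>) \<epsilon>}"


section \<open>The control system\<close>

text \<open>
  The Riemann sphere is the one-point compactification of the complex plane, with
  \<^const>\<open>None\<close> as the point at infinity.
\<close>

abbreviation sphere_top :: "complex option topology" where
  "sphere_top \<equiv> Alexandroff_compactification euclidean"

text \<open>The chart \<open>-1/x\<close>; its value at \<open>x = 0\<close> is irrelevant.\<close>

definition chart_at_inf :: "complex option \<Rightarrow> complex" where
  "chart_at_inf x = (case x of None \<Rightarrow> 0 | Some z \<Rightarrow> - 1 / z)"

definition feasible_control :: "real \<Rightarrow> real \<Rightarrow> real \<Rightarrow> (real \<Rightarrow> real) \<Rightarrow> bool" where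
  "feasible_control n1 n2 s0 \<epsilon> \<longleftrightarrow> Linf_on {s0<..} \<epsilon> \<and>
     (AE s\<in>{s0<..} in lebesgue. n1\<^sup>2 \<le> \<epsilon> s \<and> \<epsilon> s \<le> n2\<^sup>2)"

text \<open>
  Caratheodory solutions on \<open>[a, b]\<close>: each of the two differential equations holds a.e. as long
  as the state stays in the domain of the corresponding chart.
\<close>

definition trajectory ::
    "complex \<Rightarrow> (real \<Rightarrow> real) \<Rightarrow> real \<Rightarrow> real \<Rightarrow> (real \<Rightarrow> complex option) \<Rightarrow> bool" where
  "trajectory \<kappa> \<epsilon> a b x \<longleftrightarrow>
     continuous_map (top_of_set {a..b}) sphere_top x \<and>
     is_primitive {s\<in>{a..b}. x s \<noteq> None} (\<lambda>s. the (x s))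
       (\<lambda>s. \<i> * \<kappa> * (- (the (x s))\<^sup>2 + of_real (\<epsilon> s))) \<and>
     is_primitive {s\<in>{a..b}. x s \<noteq> Some 0} (\<lambda>s. chart_at_inf (x s))
       (\<lambda>s. \<i> * \<kappa> * (- 1 + of_real (\<epsilon> s) * (chart_at_inf (x s))\<^sup>2))"

definition steers :: "complex \<Rightarrow> (real \<Rightarrow> real) \<Rightarrow> real \<Rightarrow> complex option \<Rightarrow> complex option \<Rightarrow> real \<Rightarrow> bool" where
  "steers \<kappa> \<epsilon> s0 \<eta> \<eta>' t \<longleftrightarrow>
     (\<exists>x. trajectory \<kappa> \<epsilon> s0 (s0 + t) x \<and> x s0 = \<eta> \<and> x (s0 + t) = \<eta>')"

definition T_min ::
    "real \<Rightarrow> real \<Rightarrow> complex \<Rightarrow> real \<Rightarrow> complex option \<Rightarrow> complex option \<Rightarrow> ereal" where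
  "T_min n1 n2 \<kappa> s0 \<eta> \<eta>' =
     (INF t \<in> {t. t \<ge> 0 \<and> (\<exists>\<epsilon>. feasible_control n1 n2 s0 \<epsilon> \<and> steers \<kappa> \<epsilon> s0 \<eta> \<eta>' t)}. ereal t)"

definition min_time_controls ::
    "real \<Rightarrow> real \<Rightarrow> complex \<Rightarrow> real \<Rightarrow> complex option \<Rightarrow> complex option \<Rightarrow> (real \<Rightarrow> real) set" where
  "min_time_controls n1 n2 \<kappa> s0 \<eta> \<eta>' =
     {\<epsilon>. feasible_control n1 n2 s0 \<epsilon> \<and>
         (\<exists>t. T_min n1 n2 \<kappa> s0 \<eta> \<eta>' = ereal t \<and> steers \<kappa> \<epsilon> s0 \<eta> \<eta>' t)}"


section \<open>Restrictions\<close>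

text \<open>
  The restriction of \<open>f\<close> to \<open>S\<close> as an element of \<open>L\<^sup>\<infinity>(S)\<close>: the domain \<open>S\<close> together with the class
  of all functions that agree with \<open>f\<close> a.e. on \<open>S\<close>.
\<close>

definition restr :: "real set \<Rightarrow> (real \<Rightarrow> real) \<Rightarrow> real set \<times> (real \<Rightarrow> real) set" where
  "restr S f = (S, {g. AE s\<in>S in lebesgue. g s = f s})"

text \<open>
  The restrictions to \<open>(s\<^sub>0, s\<^sub>0 + T)\<close> of the minimum-time controls, where \<open>T\<close> is the minimum time,
  after the translation carrying \<open>s\<^sub>0\<close> to \<open>c\<close>. There are none if \<open>T = \<infinity>\<close>.
\<close>

definition translated_controls ::
    "real \<Rightarrow> real \<Rightarrow> complex \<Rightarrow> real \<Rightarrow> complex option \<Rightarrow> complex option \<Rightarrow> real \<Rightarrow>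
     (real set \<times> (real \<Rightarrow> real) set) set" where
  "translated_controls n1 n2 \<kappa> s0 \<eta> \<eta>' c =
     (\<lambda>\<epsilon>. restr {c<..<c + real_of_ereal (T_min n1 n2 \<kappa> s0 \<eta> \<eta>')} (\<lambda>s. \<epsilon> (s - c + s0))) `
       min_time_controls n1 n2 \<kappa> s0 \<eta> \<eta>'"

end

theory Submission
  imports Defs
begin

text \<open>
  For a solution of \<open>y'' = - \<kappa>\<^sup>2 \<epsilon> y\<close> put \<open>w = y' / (\<i> \<kappa>)\<close>. Then \<open>(y, w)\<close> solves the linear system
  \<open>y' = \<i> \<kappa> w\<close>, \<open>w' = \<i> \<kappa> \<epsilon> y\<close>, and the quotient \<open>x = w / y\<close> solves \<open>x' = \<i> \<kappa> (- x\<^sup>2 + \<epsilon>)\<close>. In other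
  words, the control system on the sphere is the projectivisation of the linear system, and \<open>[w : y]\<close> are
  homogeneous coordinates of the state. Therefore \<open>\<epsilon>\<close> steers \<open>\<eta>\<close> to \<open>\<eta>'\<close> on \<open>[a, b]\<close> if and only if a
  nontrivial linear solution represents \<open>\<eta>\<close> at \<open>a\<close> and \<open>\<eta>'\<close> at \<open>b\<close>; this relation is called \<open>transfers\<close>
  (lemma \<open>steers_iff_transfers\<close>).

  The same relation describes modes. The boundary conditions say that the state is \<open>- n\<^sub>\<infinity>\<close> at the left end and
  \<open>n\<^sub>\<infinity>\<close> at the right end, and since \<open>\<plusminus>n\<^sub>\<infinity>\<close> are equilibria where \<open>\<epsilon> = n\<^sub>\<infinity>\<^sup>2\<close>, the ends may be those of any
  interval outside of which \<open>\<epsilon>\<close> is constant (\<open>resonance_iff_transfers\<close>). For symmetric \<open>\<epsilon>\<close>, a mode is odd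
  (even) if and only if its state at \<open>0\<close> is \<open>\<infinity>\<close> (respectively \<open>0\<close>), and then the right half determines the
  left half by reflection (\<open>symmetric_mode_iff_transfers\<close>).

  Given this, coefficients and controls are exchanged by restriction to the shortest interval and by extension with
  the value \<open>n\<^sub>\<infinity>\<^sup>2\<close> (after even reflection in the symmetric problems). An extension has an interval
  inside that of the control, so the infima agree; for optimal controls the two intervals have equal length,
  hence coincide, and so do the families of minimizers (\<open>min_time_problem_equivalence\<close>).

  The analytic work lies in \<open>steers_iff_transfers\<close>, where coefficients are merely measurable. A quotient rule for
  primitives of bounded functions, applied in both charts, shows that quotients of linear solutions are
  trajectories. Conversely, along a trajectory \<open>x\<close> the defect \<open>x y - w\<close> satisfies a homogeneous linear equation
  in the finite chart, and \<open>y - w / x\<close> does in the chart at infinity, so a trajectory follows the linear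
  solution that starts at the same point. Global solvability of the linear system is obtained from a
  weighted contraction (\<open>linear_system_exists\<close>).
\<close>

section \<open>Primitives of bounded functions\<close>

lemma is_primitive_subset:
  "is_primitive S F f \<Longrightarrow> S' \<subseteq> S \<Longrightarrow> is_primitive S' F f"
  unfolding is_primitive_def by blast

lemma is_primitiveD:
  "is_primitive S F f \<Longrightarrow> c \<le> d \<Longrightarrow> {c..d} \<subseteq> S \<Longrightarrow> (f has_integral (F d - F c)) {c..d}"
  unfolding is_primitive_def by blast

text \<open>
  Only the primitive is sensitive to individual points; the integrand matters up to null sets. Thus an
  essentially bounded coefficient may be replaced by an everywhere bounded representative, which is what
  the pointwise estimates below require.
\<close>

lemma is_primitive_AE_cong:
  assumes "AE s\<in>S in lebesgue. f s = g s"
  shows "is_primitive S F f \<longleftrightarrow> is_primitive S F g"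
proof -
  obtain N where N: "N \<in> null_sets lebesgue" "{s \<in> space lebesgue. \<not> (s \<in> S \<longrightarrow> f s = g s)} \<subseteq> N"
    using assms unfolding eventually_ae_filter by blast
  have "(f has_integral I) {c..d} \<longleftrightarrow> (g has_integral I) {c..d}" if "{c..d} \<subseteq> S" for c d I
    using N that by (intro has_integral_spike_eq[of N]) (fastforce simp: negligible_iff_null_sets)+
  then show ?thesis unfolding is_primitive_def by auto
qed

lemma is_primitive_cong:
  assumes "\<And>s. s \<in> S \<Longrightarrow> F s = G s" "\<And>s. s \<in> S \<Longrightarrow> f s = g s"
  shows "is_primitive S F f \<longleftrightarrow> is_primitive S G g"
proof -
  have "((f has_integral (F d - F c)) {c..d}) = ((g has_integral (G d - G c)) {c..d})"
    if "c \<le> d" "{c..d} \<subseteq> S" for c d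
  proof -
    have "F d - F c = G d - G c" using assms(1)[of c] assms(1)[of d] that by (simp add: subset_iff)
    moreover have "(f has_integral I) {c..d} \<longleftrightarrow> (g has_integral I) {c..d}" for I
      using that assms(2) by (intro has_integral_cong) auto
    ultimately show ?thesis by simp
  qed
  then show ?thesis unfolding is_primitive_def by auto
qed

lemma continuous_on_has_integral_primitive:
  fixes u f :: "real \<Rightarrow> 'a::euclidean_space"
  assumes "\<And>t. t \<in> {a..b} \<Longrightarrow> (f has_integral (u t - u a)) {a..t}"
  shows "continuous_on {a..b} u"
proof (cases "a \<le> b")
  case True
  have "f integrable_on {a..b}" using assms[of b] True by (auto simp: has_integral_integrable)
  then have "continuous_on {a..b} (\<lambda>t. u a + integral {a..t} f)"
    by (intro continuous_intros indefinite_integral_continuous_1)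
  moreover have "u a + integral {a..t} f = u t" if "t \<in> {a..b}" for t
    using assms[OF that] by (simp add: integral_unique)
  ultimately show ?thesis by (rule continuous_on_eq)
qed auto

lemma is_primitive_continuous_on:
  "is_primitive S F f \<Longrightarrow> {c..d} \<subseteq> S \<Longrightarrow> continuous_on {c..d} F"
  by (rule continuous_on_has_integral_primitive[where f = f]) (auto intro!: is_primitiveD)

lemma continuous_on_UNIV_Icc:
  fixes F :: "real \<Rightarrow> 'a::topological_space"
  assumes "\<And>n. continuous_on {-n..n} F"
  shows "continuous_on UNIV F"
proof (rule continuous_at_imp_continuous_on, rule ballI)
  fix s :: real
  have "s \<in> interior {-(\<bar>s\<bar>+1)..\<bar>s\<bar>+1}" by (auto simp: interior_atLeastAtMost_real)
  then show "isCont F s" using assms continuous_on_interior by blast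
qed

lemma is_primitive_UNIV_continuous_on:
  "is_primitive UNIV F f \<Longrightarrow> continuous_on S F"
  by (rule continuous_on_subset[OF continuous_on_UNIV_Icc]) (auto intro: is_primitive_continuous_on)

lemma is_primitive_add:
  assumes "is_primitive S F f" "is_primitive S G g"
  shows "is_primitive S (\<lambda>s. F s + G s) (\<lambda>s. f s + g s)"
  unfolding is_primitive_def
proof (intro allI impI)
  fix c d assume "c \<le> d \<and> {c..d} \<subseteq> S"
  then show "((\<lambda>s. f s + g s) has_integral F d + G d - (F c + G c)) {c..d}"
    using has_integral_add[OF is_primitiveD[OF assms(1)] is_primitiveD[OF assms(2)], of c d]
    by (simp add: algebra_simps)
qed

lemma is_primitive_cmult:
  assumes "is_primitive S F f"
  shows "is_primitive S (\<lambda>s. k * F s) (\<lambda>s. k * f s)"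
  unfolding is_primitive_def
proof (intro allI impI)
  fix c d assume "c \<le> d \<and> {c..d} \<subseteq> S"
  then show "((\<lambda>s. k * f s) has_integral k * F d - k * F c) {c..d}"
    using has_integral_mult_right[OF is_primitiveD[OF assms(1)], of c d k]
    by (simp add: algebra_simps)
qed

lemma is_primitive_shift:
  assumes "is_primitive {c + h..d + h} F f"
  shows "is_primitive {c..d} (\<lambda>s. F (s + h)) (\<lambda>s. f (s + h))"
  unfolding is_primitive_def
proof (intro allI impI)
  fix p q assume "p \<le> q \<and> {p..q} \<subseteq> {c..d}"
  then have "(f has_integral F (q + h) - F (p + h)) {p + h..q + h}"
    by (intro is_primitiveD[OF assms]) auto
  from has_integral_shift_real_ivl[OF this, of h]
  show "((\<lambda>s. f (s + h)) has_integral F (q + h) - F (p + h)) {p..q}" by simp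
qed

lemma is_primitive_reflect:
  assumes "is_primitive UNIV F f"
  shows "is_primitive UNIV (\<lambda>s. F (- s)) (\<lambda>s. - f (- s))"
  unfolding is_primitive_def
proof (intro allI impI)
  fix p q :: real assume "p \<le> q \<and> {p..q} \<subseteq> UNIV"
  then have "(f has_integral F (- p) - F (- q)) {- q..- p}"
    by (intro is_primitiveD[OF assms]) auto
  from has_integral_reflect_lemma_real[OF this]
  have "((\<lambda>s. f (- s)) has_integral F (- p) - F (- q)) {p..q}" by simp
  from has_integral_neg[OF this] show "((\<lambda>s. - f (- s)) has_integral F (- q) - F (- p)) {p..q}"
    by simp
qed

lemma is_primitive_integral:
  assumes "f integrable_on {c..d}" "c \<le> d"
  shows "is_primitive {c..d} (\<lambda>t. integral {c..t} f) f"
  unfolding is_primitive_def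
proof (intro allI impI)
  fix p q assume *: "p \<le> q \<and> {p..q} \<subseteq> {c..d}"
  have "f integrable_on {p..q}" "f integrable_on {c..q}"
    using assms * by (auto intro: integrable_on_subinterval)
  moreover have "integral {c..p} f + integral {p..q} f = integral {c..q} f"
    using * assms calculation by (intro Henstock_Kurzweil_Integration.integral_combine) auto
  ultimately show "(f has_integral integral {c..q} f - integral {c..p} f) {p..q}"
    by (simp add: has_integral_iff algebra_simps)
qed

text \<open>
  Primitives of merely bounded functions need not be differentiable everywhere, so the
  calculus rules cannot be read off from pointwise derivatives.
  They follow from the next lemma: it suffices to compare, over each interval \<open>[s, t]\<close>,
  the increment of \<open>H\<close> with the integral of an approximation of \<open>h\<close> in which the continuous factors
  are frozen at \<open>s\<close> or \<open>t\<close>. The error is quadratic in the length of the interval, so \<open>H\<close> differs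
  from the indefinite integral of \<open>h\<close> by a function with zero derivative.
\<close>

lemma is_primitive_if_approx:
  fixes H h :: "real \<Rightarrow> complex"
  assumes int: "h integrable_on {c..d}"
    and approx: "\<And>s t. c \<le> s \<Longrightarrow> s \<le> t \<Longrightarrow> t \<le> d \<Longrightarrow>
      \<exists>\<phi>. (\<phi> has_integral (H t - H s)) {s..t} \<and> (\<forall>r\<in>{s..t}. norm (\<phi> r - h r) \<le> C * (t - s))"
  shows "is_primitive {c..d} H h"
proof (cases "c \<le> d")
  case False
  then show ?thesis by (auto simp: is_primitive_def)
next
  case True
  define K where "K = (\<lambda>t. integral {c..t} h)"
  have K: "is_primitive {c..d} K h"
    using is_primitive_integral[OF int True] by (simp add: K_def)
  define D where "D = (\<lambda>t. H t - K t)"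
  have quad: "norm (D t - D s) \<le> \<bar>C\<bar> * (t - s)^2" if st: "c \<le> s" "s \<le> t" "t \<le> d" for s t
  proof -
    obtain \<phi> where \<phi>: "(\<phi> has_integral (H t - H s)) {s..t}"
      "\<forall>r\<in>{s..t}. norm (\<phi> r - h r) \<le> C * (t - s)"
      using approx[OF st] by blast
    have "(h has_integral (K t - K s)) {s..t}" using K st by (intro is_primitiveD) auto
    from has_integral_diff[OF \<phi>(1) this]
    have "((\<lambda>r. \<phi> r - h r) has_integral (D t - D s)) {s..t}" by (simp add: D_def algebra_simps)
    moreover have "norm (\<phi> r - h r) \<le> \<bar>C\<bar> * (t - s)" if "r \<in> {s..t}" for r
    proof -
      have "C * (t - s) \<le> \<bar>C\<bar> * (t - s)" using st by (intro mult_right_mono) auto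
      then show ?thesis using \<phi>(2) that by (meson order_trans)
    qed
    ultimately have "norm (D t - D s) \<le> \<bar>C\<bar> * (t - s) * measure lborel {s..t}"
      using st by (intro has_integral_bound_real[where f = "\<lambda>r. \<phi> r - h r" and S = "{}"]) auto
    then show ?thesis using st by (simp add: power2_eq_square)
  qed
  have quad': "norm (D t - D s) \<le> \<bar>C\<bar> * (t - s)^2" if "s \<in> {c..d}" "t \<in> {c..d}" for s t
    using quad[of s t] quad[of t s] that
    by (cases "s \<le> t") (auto simp: norm_minus_commute power2_commute)
  have "(D has_vector_derivative 0) (at s within {c..d})" if s: "s \<in> {c..d}" for s
    unfolding has_vector_derivative_def has_derivative_within_alt
  proof (intro conjI allI impI)
    show "bounded_linear (\<lambda>x. x *\<^sub>R (0::complex))" by simp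
    fix e :: real assume e: "e > 0"
    show "\<exists>\<delta>>0. \<forall>t\<in>{c..d}. norm (t - s) < \<delta> \<longrightarrow> norm (D t - D s - (t - s) *\<^sub>R 0) \<le> e * norm (t - s)"
    proof (intro exI[of _ "e / (\<bar>C\<bar> + 1)"] conjI ballI impI)
      show "e / (\<bar>C\<bar> + 1) > 0" using e by (simp add: add_nonneg_pos)
      fix t assume t: "t \<in> {c..d}" "norm (t - s) < e / (\<bar>C\<bar> + 1)"
      then have "(\<bar>C\<bar> + 1) * \<bar>t - s\<bar> < e" by (simp add: field_simps)
      then have "\<bar>C\<bar> * \<bar>t - s\<bar> \<le> e" by (simp add: algebra_simps)
      then have "\<bar>C\<bar> * \<bar>t - s\<bar> * \<bar>t - s\<bar> \<le> e * \<bar>t - s\<bar>" by (intro mult_right_mono) auto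
      moreover have "\<bar>C\<bar> * (t - s)^2 = \<bar>C\<bar> * \<bar>t - s\<bar> * \<bar>t - s\<bar>"
        by (metis abs_mult_self_eq mult.assoc power2_eq_square)
      ultimately show "norm (D t - D s - (t - s) *\<^sub>R 0) \<le> e * norm (t - s)"
        using quad'[OF s t(1)] by (simp only: scaleR_zero_right diff_zero real_norm_def)
    qed
  qed
  then obtain k where k: "\<And>s. s \<in> {c..d} \<Longrightarrow> D s = k"
    using has_vector_derivative_zero_constant[of "{c..d}" D] by auto
  have HK: "H s = K s + k" if "s \<in> {c..d}" for s using k[OF that] by (simp add: D_def algebra_simps)
  show ?thesis unfolding is_primitive_def
  proof (intro allI impI)
    fix p q assume pq: "p \<le> q \<and> {p..q} \<subseteq> {c..d}"
    then have "p \<in> {c..d}" "q \<in> {c..d}" by auto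
    then have "H q - H p = K q - K p" by (simp add: HK)
    then show "(h has_integral H q - H p) {p..q}" using is_primitiveD[OF K] pq by simp
  qed
qed

lemma is_primitive_Lipschitz:
  assumes "is_primitive {c..d} F f" "\<And>s. s \<in> {c..d} \<Longrightarrow> norm (f s) \<le> B"
    and "s \<in> {c..d}" "t \<in> {c..d}"
  shows "norm (F t - F s) \<le> B * \<bar>t - s\<bar>"
proof -
  have B: "0 \<le> B" using order_trans[OF norm_ge_zero assms(2)[OF assms(3)]] .
  have *: "norm (F t - F s) \<le> B * \<bar>t - s\<bar>" if "c \<le> s" "s \<le> t" "t \<le> d" for s t
  proof -
    have "(f has_integral F t - F s) {s..t}" using that by (intro is_primitiveD[OF assms(1)]) auto
    then have "norm (F t - F s) \<le> B * measure lborel {s..t}"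
      using that assms(2) B by (intro has_integral_bound_real[where f = f and S = "{}"]) auto
    then show ?thesis using that by simp
  qed
  show ?thesis using *[of s t] *[of t s] assms(3,4)
    by (cases "s \<le> t") (auto simp: norm_minus_commute abs_minus_commute)
qed

lemma bounded_on_Icc:
  fixes F :: "real \<Rightarrow> complex"
  assumes "continuous_on {c..d} F"
  obtains M where "M > 0" "\<And>s. s \<in> {c..d} \<Longrightarrow> norm (F s) \<le> M"
  using compact_imp_bounded[OF compact_continuous_image[OF assms compact_Icc]]
  by (auto simp: bounded_pos)

lemma integrable_continuous_times_bounded:
  fixes f G :: "real \<Rightarrow> complex"
  assumes "f integrable_on {c..d}" "\<And>s. s \<in> {c..d} \<Longrightarrow> norm (f s) \<le> B" "continuous_on {c..d} G"
  shows "(\<lambda>s. f s * G s) integrable_on {c..d}"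
proof -
  obtain M where M: "M > 0" "\<And>s. s \<in> {c..d} \<Longrightarrow> norm (G s) \<le> M"
    using bounded_on_Icc[OF assms(3)] by blast
  have "f \<in> borel_measurable (lebesgue_on {c..d})" using assms(1) integrable_imp_measurable by blast
  moreover have "G \<in> borel_measurable (lebesgue_on {c..d})"
    using assms(3) by (intro continuous_imp_measurable_on_sets_lebesgue) auto
  ultimately have meas: "(\<lambda>s. f s * G s) \<in> borel_measurable (lebesgue_on {c..d})" by measurable
  show ?thesis
  proof (rule measurable_bounded_by_integrable_imp_integrable[OF meas, of "\<lambda>_. B * M"])
    fix s assume "s \<in> {c..d}"
    then show "norm (f s * G s) \<le> B * M"
      using assms(2)[of s] M order_trans[OF norm_ge_zero assms(2)[of s]]
      by (auto simp: norm_mult intro!: mult_mono)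
  qed auto
qed

text \<open>
  The exact identity \<open>F t * G t - F s * G s = (F t - F s) * G t + (G t - G s) * F s\<close> says which factors
  to freeze; unfreezing them costs a Lipschitz error.
\<close>

lemma is_primitive_mult:
  assumes F: "is_primitive {c..d} F f" and f: "\<And>s. s \<in> {c..d} \<Longrightarrow> norm (f s) \<le> A"
    and G: "is_primitive {c..d} G g" and g: "\<And>s. s \<in> {c..d} \<Longrightarrow> norm (g s) \<le> B"
  shows "is_primitive {c..d} (\<lambda>s. F s * G s) (\<lambda>s. f s * G s + g s * F s)"
proof (cases "c \<le> d")
  case False
  then show ?thesis by (auto simp: is_primitive_def)
next
  case True
  have contF: "continuous_on {c..d} F" using is_primitive_continuous_on[OF F] by simp
  have contG: "continuous_on {c..d} G" using is_primitive_continuous_on[OF G] by simp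
  have intf: "f integrable_on {c..d}" using is_primitiveD[OF F, of c d] True by (auto simp: has_integral_integrable)
  have intg: "g integrable_on {c..d}" using is_primitiveD[OF G, of c d] True by (auto simp: has_integral_integrable)
  have A: "0 \<le> A" "0 \<le> B"
    using order_trans[OF norm_ge_zero f[of c]] order_trans[OF norm_ge_zero g[of c]] True by auto
  show ?thesis
  proof (rule is_primitive_if_approx[where C = "A * B + B * A"])
    show "(\<lambda>s. f s * G s + g s * F s) integrable_on {c..d}"
      using integrable_continuous_times_bounded[OF intf f contG]
        integrable_continuous_times_bounded[OF intg g contF] by (rule integrable_add)
    fix s t assume st: "c \<le> s" "s \<le> t" "t \<le> d"
    let ?\<phi> = "\<lambda>r. f r * G t + g r * F s"
    have "(f has_integral F t - F s) {s..t}" "(g has_integral G t - G s) {s..t}"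
      using st by (auto intro!: is_primitiveD[OF F] is_primitiveD[OF G])
    from has_integral_add[OF has_integral_mult_left[OF this(1), of "G t"] has_integral_mult_left[OF this(2), of "F s"]]
    have "(?\<phi> has_integral (F t * G t - F s * G s)) {s..t}"
      by (simp add: algebra_simps)
    moreover have "norm (?\<phi> r - (f r * G r + g r * F r)) \<le> (A * B + B * A) * (t - s)"
      if r: "r \<in> {s..t}" for r
    proof -
      have "norm (G t - G r) \<le> B * \<bar>t - r\<bar>" using st r by (intro is_primitive_Lipschitz[OF G g]) auto
      also have "\<dots> \<le> B * (t - s)" using r A by (intro mult_left_mono) auto
      finally have 1: "norm (G t - G r) \<le> B * (t - s)" .
      have "norm (F s - F r) \<le> A * \<bar>s - r\<bar>" using st r by (intro is_primitive_Lipschitz[OF F f]) auto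
      also have "\<dots> \<le> A * (t - s)" using r A by (intro mult_left_mono) auto
      finally have 2: "norm (F s - F r) \<le> A * (t - s)" .
      have "?\<phi> r - (f r * G r + g r * F r) = f r * (G t - G r) + g r * (F s - F r)"
        by (simp add: algebra_simps)
      also have "norm \<dots> \<le> A * (B * (t - s)) + B * (A * (t - s))"
        using 1 2 f[of r] g[of r] st r A unfolding norm_mult[symmetric]
        by (intro order_trans[OF norm_triangle_ineq] add_mono) (auto simp: norm_mult intro!: mult_mono)
      finally show ?thesis by (simp add: algebra_simps)
    qed
    ultimately show "\<exists>\<phi>. (\<phi> has_integral (F t * G t - F s * G s)) {s..t} \<and>
       (\<forall>r\<in>{s..t}. norm (\<phi> r - (f r * G r + g r * F r)) \<le> (A * B + B * A) * (t - s))" by blast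
  qed
qed

lemma is_primitive_inverse:
  assumes G: "is_primitive {c..d} G g" and g: "\<And>s. s \<in> {c..d} \<Longrightarrow> norm (g s) \<le> B"
    and nz: "\<And>s. s \<in> {c..d} \<Longrightarrow> G s \<noteq> 0"
  shows "is_primitive {c..d} (\<lambda>s. inverse (G s)) (\<lambda>s. - (g s * (inverse (G s))\<^sup>2))"
proof (cases "c \<le> d")
  case False
  then show ?thesis by (auto simp: is_primitive_def)
next
  case True
  have contG: "continuous_on {c..d} G" using is_primitive_continuous_on[OF G] by simp
  have contI: "continuous_on {c..d} (\<lambda>s. inverse (G s))"
    using nz by (intro continuous_on_inverse contG) auto
  have intg: "g integrable_on {c..d}" using is_primitiveD[OF G, of c d] True by (auto simp: has_integral_integrable)
  have B: "0 \<le> B" using order_trans[OF norm_ge_zero g[of c]] True by auto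
  obtain M where M: "M > 0" "\<And>s. s \<in> {c..d} \<Longrightarrow> norm (inverse (G s)) \<le> M"
    using bounded_on_Icc[OF contI] by blast
  have invlip: "norm (inverse (G t) - inverse (G r)) \<le> M * M * B * \<bar>t - r\<bar>"
    if "r \<in> {c..d}" "t \<in> {c..d}" for r t
  proof -
    have "inverse (G t) - inverse (G r) = - (inverse (G t) * inverse (G r) * (G t - G r))"
      using nz that by (simp add: field_simps)
    also have "norm \<dots> \<le> (M * M) * (B * \<bar>t - r\<bar>)"
      unfolding norm_minus_cancel norm_mult
      using M that is_primitive_Lipschitz[OF G g that(1,2)] by (intro mult_mono) auto
    finally show ?thesis by (simp add: algebra_simps)
  qed
  show ?thesis
  proof (rule is_primitive_if_approx[where C = "B * (M * (M * M * B) + M * (M * M * B))"])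
    show "(\<lambda>s. - (g s * (inverse (G s))\<^sup>2)) integrable_on {c..d}"
      by (intro integrable_neg integrable_continuous_times_bounded[OF intg g] continuous_on_power contI)
    fix s t assume st: "c \<le> s" "s \<le> t" "t \<le> d"
    let ?J = "\<lambda>s. inverse (G s)"
    \<comment> \<open>From \<open>1 / G t - 1 / G s = - (G t - G s) / (G t * G s)\<close>.\<close>
    let ?\<phi> = "\<lambda>r. g r * - (?J t * ?J s)"
    have "(g has_integral G t - G s) {s..t}"
      using st by (auto intro!: is_primitiveD[OF G])
    then have "(?\<phi> has_integral (G t - G s) * - (?J t * ?J s)) {s..t}"
      by (rule has_integral_mult_left)
    moreover have "(G t - G s) * - (?J t * ?J s) = ?J t - ?J s"
      using nz[of s] nz[of t] st by (simp add: field_simps)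
    ultimately have "(?\<phi> has_integral (?J t - ?J s)) {s..t}" by (simp only:)
    moreover have "norm (?\<phi> r - - (g r * (?J r)\<^sup>2)) \<le> B * (M * (M * M * B) + M * (M * M * B)) * (t - s)"
      if r: "r \<in> {s..t}" for r
    proof -
      have L: "M * M * B * \<bar>x\<bar> \<le> M * M * B * (t - s)" if "\<bar>x\<bar> \<le> t - s" for x
        using that B M by (intro mult_left_mono) auto
      have 1: "norm (?J r - ?J s) \<le> M * M * B * (t - s)"
        using invlip[of s r] L[of "r - s"] st r by auto
      have 2: "norm (?J r - ?J t) \<le> M * M * B * (t - s)"
        using invlip[of t r] L[of "r - t"] st r by auto
      have "?\<phi> r - - (g r * (?J r)\<^sup>2) = g r * (?J r * (?J r - ?J s) + ?J s * (?J r - ?J t))"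
        by (simp add: algebra_simps power2_eq_square)
      also have "norm \<dots> \<le> B * (M * (M * M * B * (t - s)) + M * (M * M * B * (t - s)))"
        unfolding norm_mult using 1 2 g[of r] M st r B
        by (intro mult_mono order_trans[OF norm_triangle_ineq] add_mono) (auto simp: norm_mult intro!: mult_mono)
      finally show ?thesis by (simp add: algebra_simps)
    qed
    ultimately show "\<exists>\<phi>. (\<phi> has_integral (?J t - ?J s)) {s..t} \<and>
       (\<forall>r\<in>{s..t}. norm (\<phi> r - - (g r * (?J r)\<^sup>2)) \<le> B * (M * (M * M * B) + M * (M * M * B)) * (t - s))"
      by blast
  qed
qed

text \<open>
  On an interval shorter than \<open>1 / (2 * K)\<close> with a zero of \<open>u\<close> at an end point, the maximum of
  \<open>norm u\<close> is at most half of itself; such intervals cover \<open>[a, b]\<close>.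
  Uniqueness for the linear system and the propagation of linear relations between
  its solutions both reduce to this.
\<close>

lemma primitive_zero_propagates:
  fixes u f :: "real \<Rightarrow> 'a::euclidean_space"
  assumes I: "\<And>c d. a \<le> c \<Longrightarrow> c \<le> d \<Longrightarrow> d \<le> b \<Longrightarrow> (f has_integral (u d - u c)) {c..d}"
    and K: "\<And>s. s \<in> {a..b} \<Longrightarrow> norm (f s) \<le> K * norm (u s)"
    and p: "p \<in> {a..b}" "u p = 0" and q: "q \<in> {a..b}"
  shows "u q = 0"
proof -
  \<comment> \<open>Adding \<open>1\<close> covers \<open>K = 0\<close>.\<close>
  define \<delta> where "\<delta> = 1 / (2 * (\<bar>K\<bar> + 1))"
  have \<delta>: "\<delta> > 0" "\<bar>K\<bar> * \<delta> \<le> 1 / 2" by (auto simp: \<delta>_def field_simps)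
  have short: "u c = 0 \<longleftrightarrow> u d = 0" if cd: "a \<le> c" "c \<le> d" "d \<le> b" "d - c < \<delta>" for c d
  proof -
    have cont: "continuous_on {c..d} (\<lambda>s. norm (u s))"
      using cd by (intro continuous_intros continuous_on_has_integral_primitive[where f = f] I) auto
    obtain r where r: "r \<in> {c..d}" "\<And>s. s \<in> {c..d} \<Longrightarrow> norm (u s) \<le> norm (u r)"
      using continuous_attains_sup[OF compact_Icc _ cont] cd by auto
    have lip: "norm (u t - u s) \<le> norm (u r) / 2" if st: "c \<le> s" "s \<le> t" "t \<le> d" for s t
    proof -
      have "norm (f x) \<le> \<bar>K\<bar> * norm (u r)" if "x \<in> {s..t}" for x
      proof -
        have "norm (f x) \<le> K * norm (u x)" using that st cd by (intro K) auto
        also have "\<dots> \<le> \<bar>K\<bar> * norm (u r)" using that st by (intro mult_mono r) auto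
        finally show ?thesis .
      qed
      then have "norm (u t - u s) \<le> \<bar>K\<bar> * norm (u r) * measure lborel {s..t}"
        using st cd by (intro has_integral_bound_real[where f = f and S = "{}"] I) auto
      also have "\<dots> \<le> \<bar>K\<bar> * norm (u r) * \<delta>" using st cd by (intro mult_left_mono) auto
      also have "\<dots> = norm (u r) * (\<bar>K\<bar> * \<delta>)" by simp
      also have "\<dots> \<le> norm (u r) * (1 / 2)" using \<delta>(2) by (intro mult_left_mono) auto
      finally show ?thesis by simp
    qed
    have "norm (u r) = 0" if "u c = 0" using lip[of c r] r that by auto
    moreover have "norm (u r) = 0" if "u d = 0" using lip[of r d] r that by auto
    ultimately show ?thesis using r(2)[of c] r(2)[of d] cd by auto
  qed
  have "u c = 0 \<longleftrightarrow> u d = 0" if cd: "a \<le> c" "c \<le> d" "d \<le> b" for c d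
  proof -
    have "a \<le> c \<longrightarrow> d \<le> b \<longrightarrow> (u c = 0 \<longleftrightarrow> u d = 0)"
    proof (rule Bolzano[where P = "\<lambda>s t. a \<le> s \<longrightarrow> t \<le> b \<longrightarrow> (u s = 0 \<longleftrightarrow> u t = 0)", OF cd(2)])
      show "\<exists>\<delta>>0. \<forall>s t. s \<le> x \<and> x \<le> t \<and> t - s < \<delta> \<longrightarrow> a \<le> s \<longrightarrow> t \<le> b \<longrightarrow> (u s = 0 \<longleftrightarrow> u t = 0)" for x
        using short \<delta>(1) by (intro exI[of _ \<delta>]) auto
    qed auto
    then show ?thesis using cd by simp
  qed
  from this[of p q] this[of q p] show ?thesis using p q by (cases "p \<le> q") auto
qed

section \<open>Linear systems on the whole line\<close>

definition primitive_from :: "real \<Rightarrow> (real \<Rightarrow> complex) \<Rightarrow> real \<Rightarrow> complex" where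
  "primitive_from a f t = (if a \<le> t then integral {a..t} f else - integral {t..a} f)"

lemma primitive_from_base [simp]: "primitive_from a f a = 0"
  by (simp add: primitive_from_def)

lemma is_primitive_primitive_from:
  assumes "\<And>c d. f integrable_on {c..d}"
  shows "is_primitive UNIV (primitive_from a f) f"
  unfolding is_primitive_def
proof (intro allI impI)
  fix c d :: real assume cd: "c \<le> d \<and> {c..d} \<subseteq> UNIV"
  note comb = Henstock_Kurzweil_Integration.integral_combine[OF _ _ assms]
  have "primitive_from a f d - primitive_from a f c = integral {c..d} f"
  proof -
    consider "a \<le> c" | "c < a" "a \<le> d" | "d < a" by linarith
    then show ?thesis
    proof cases
      case 1
      then show ?thesis using comb[of a c d] cd by (simp add: primitive_from_def algebra_simps)
    next
      case 2
      then show ?thesis using comb[of c a d] cd by (simp add: primitive_from_def algebra_simps)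
    next
      case 3
      then show ?thesis using comb[of c d a] cd by (simp add: primitive_from_def algebra_simps)
    qed
  qed
  then show "(f has_integral primitive_from a f d - primitive_from a f c) {c..d}"
    using assms by (simp add: has_integral_iff)
qed

text \<open>
  Integrating the weight \<open>exp (\<mu> * \<bar>s - a\<bar>)\<close> reproduces it with the gain \<open>1 / \<mu>\<close>. For \<open>t < a\<close> the
  estimate is reflected at the origin.
\<close>

lemma is_primitive_exp_bound:
  assumes F: "is_primitive UNIV F f" "F a = 0" and \<mu>: "0 < \<mu>"
    and f: "\<And>s. norm (f s) \<le> K * exp (\<mu> * \<bar>s - a\<bar>)"
  shows "norm (F t) \<le> K / \<mu> * exp (\<mu> * \<bar>t - a\<bar>)"
proof -
  have K: "0 \<le> K" using order_trans[OF norm_ge_zero f[of a]] by simp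
  have right: "norm (F t) \<le> K / \<mu> * exp (\<mu> * \<bar>t - a\<bar>)"
    if F: "is_primitive UNIV F f" "F a = 0"
      and f: "\<And>s. norm (f s) \<le> K * exp (\<mu> * \<bar>s - a\<bar>)" and t: "a \<le> t" for F f a t
  proof -
    have int: "(f has_integral F t) {a..t}" using is_primitiveD[OF F(1) t] F(2) by simp
    have "((\<lambda>s. K / \<mu> * exp (\<mu> * (s - a))) has_vector_derivative K * exp (\<mu> * (s - a))) (at s within {a..t})" for s
      using \<mu> by (auto intro!: derivative_eq_intros simp: has_real_derivative_iff_has_vector_derivative[symmetric])
    from fundamental_theorem_of_calculus[OF t this]
    have int': "((\<lambda>s. K * exp (\<mu> * (s - a))) has_integral K / \<mu> * exp (\<mu> * (t - a)) - K / \<mu>) {a..t}" by simp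
    have "norm (integral {a..t} f) \<le> integral {a..t} (\<lambda>s. K * exp (\<mu> * (s - a)))"
    proof (rule Henstock_Kurzweil_Integration.integral_norm_bound_integral)
      fix s assume "s \<in> {a..t}"
      then show "norm (f s) \<le> K * exp (\<mu> * (s - a))" using f[of s] by simp
    qed (use int int' in \<open>auto simp: has_integral_iff\<close>)
    then have "norm (F t) \<le> K / \<mu> * exp (\<mu> * (t - a)) - K / \<mu>"
      using int int' by (simp add: has_integral_iff)
    also have "\<dots> \<le> K / \<mu> * exp (\<mu> * (t - a))" using K \<mu> by simp
    finally show ?thesis using t by simp
  qed
  show ?thesis
  proof (cases "a \<le> t")
    case True
    then show ?thesis using right[OF F f] by blast
  next
    case False
    have "norm (- f (- s)) \<le> K * exp (\<mu> * \<bar>s - - a\<bar>)" for s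
      using f[of "- s"] abs_minus_commute[of "- s" a] by (simp add: add.commute)
    from right[OF is_primitive_reflect[OF F(1)] _ this, of "- t"]
    show ?thesis using F(2) False by (simp add: abs_minus_commute)
  qed
qed

text \<open>
  Banach's fixed point theorem gives a solution on the whole line at once: the substitution
  \<open>y t = exp (\<mu> * \<bar>t - a\<bar>) * u t\<close> turns the integral equation
  \<open>y = y0 + k * \<integral> (w0 + \<integral> q * y)\<close> into one for a bounded continuous \<open>u\<close>, and each of the two
  integrations gains a factor \<open>1 / \<mu>\<close>, so that the operator is a contraction once \<open>\<mu>\<close> is large.
\<close>

lemma linear_system_exists:
  fixes q :: "real \<Rightarrow> complex" and k y0 w0 :: complex and a :: real
  assumes q: "\<And>c d. q integrable_on {c..d}" and K: "\<And>s. norm (q s) \<le> K"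
  obtains y w where "is_primitive UNIV y (\<lambda>s. k * w s)" "is_primitive UNIV w (\<lambda>s. q s * y s)"
    "y a = y0" "w a = w0"
proof -
  have K0: "0 \<le> K" using order_trans[OF norm_ge_zero K[of a]] .
  \<comment> \<open>Large enough for \<open>norm k * K / \<mu>\<^sup>2 \<le> 1 / 2\<close>.\<close>
  define \<mu> where "\<mu> = 2 * (norm k * K) + 1"
  have \<mu>: "\<mu> \<ge> 1" using K0 by (simp add: \<mu>_def)
  have contraction: "norm k * (K / \<mu> / \<mu>) \<le> 1 / 2"
  proof -
    have "norm k * K * 2 \<le> \<mu> * 1" by (simp add: \<mu>_def)
    also have "\<dots> \<le> \<mu> * \<mu>" using \<mu> by (intro mult_left_mono) auto
    finally show ?thesis using \<mu> by (simp add: field_simps)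
  qed
  define e where "e t = exp (\<mu> * \<bar>t - a\<bar>)" for t
  have e: "e t \<ge> 1" "e t > 0" for t using \<mu> by (auto simp: e_def)
  have e_cont: "continuous_on S (\<lambda>t. complex_of_real (e t))" for S
    unfolding e_def by (intro continuous_intros)
  \<comment> \<open>\<open>Z u\<close> is one Picard step applied to \<open>Y u\<close>, with \<open>W u\<close> as the intermediate second component.\<close>
  define Y where "Y u t = complex_of_real (e t) * apply_bcontfun u t" for u t
  define W where "W u t = w0 + primitive_from a (\<lambda>s. q s * Y u s) t" for u t
  define Z where "Z u t = y0 + k * primitive_from a (W u) t" for u t
  have Y_cont: "continuous_on S (Y u)" for S u
    unfolding Y_def by (intro continuous_intros e_cont) auto
  have qY: "(\<lambda>s. q s * Y u s) integrable_on {c..d}" for u c d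
    using q K Y_cont by (rule integrable_continuous_times_bounded)
  have W_prim: "is_primitive UNIV (\<lambda>t. primitive_from a (\<lambda>s. q s * Y u s) t) (\<lambda>s. q s * Y u s)" for u
    by (rule is_primitive_primitive_from[OF qY])
  have W_cont: "continuous_on S (W u)" for S u
    unfolding W_def by (intro continuous_intros is_primitive_UNIV_continuous_on[OF W_prim])
  have Z_prim: "is_primitive UNIV (primitive_from a (W u)) (W u)" for u
    by (rule is_primitive_primitive_from) (intro integrable_continuous_real W_cont)
  have Z_cont: "continuous_on S (Z u)" for S u
    unfolding Z_def by (intro continuous_intros is_primitive_UNIV_continuous_on[OF Z_prim])
  have bW: "norm (W u t) \<le> (norm w0 + K * B / \<mu>) * e t"
    if "\<And>s. norm (apply_bcontfun u s) \<le> B" for u t B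
  proof -
    have "norm (q s * Y u s) \<le> K * B * e s" for s
    proof -
      have "norm (q s * Y u s) = norm (q s) * norm (apply_bcontfun u s) * e s"
        using e(2)[of s] by (simp add: norm_mult Y_def)
      also have "\<dots> \<le> K * B * e s" using K K0 that[of s] e(2)[of s] order_trans[OF norm_ge_zero that[of s]]
        by (intro mult_mono) auto
      finally show ?thesis .
    qed
    then have "norm (primitive_from a (\<lambda>s. q s * Y u s) t) \<le> K * B / \<mu> * e t"
      unfolding e_def using \<mu> by (intro is_primitive_exp_bound[OF W_prim]) auto
    moreover have "norm w0 \<le> norm w0 * e t" using e(1)[of t] by (simp add: mult_le_cancel_left1)
    ultimately show ?thesis unfolding W_def
      by (intro order_trans[OF norm_triangle_ineq]) (simp add: algebra_simps)
  qed
  have bZ: "norm (Z u t) \<le> (norm y0 + norm k * ((norm w0 + K * B / \<mu>) / \<mu>)) * e t"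
    if "\<And>s. norm (apply_bcontfun u s) \<le> B" for u t B
  proof -
    have "norm (primitive_from a (W u) t) \<le> (norm w0 + K * B / \<mu>) / \<mu> * e t"
      unfolding e_def using \<mu> bW[OF that, unfolded e_def] by (intro is_primitive_exp_bound[OF Z_prim]) auto
    then have "norm k * norm (primitive_from a (W u) t) \<le> norm k * ((norm w0 + K * B / \<mu>) / \<mu> * e t)"
      by (intro mult_left_mono) auto
    moreover have "norm y0 \<le> norm y0 * e t" using e(1)[of t] by (simp add: mult_le_cancel_left1)
    ultimately show ?thesis unfolding Z_def
      by (intro order_trans[OF norm_triangle_ineq]) (simp add: algebra_simps norm_mult)
  qed
  have lip: "norm (Z u t - Z v t) \<le> 1 / 2 * dist u v * e t" for u v t
  proof -
    have "norm (q s * Y u s - q s * Y v s) \<le> K * dist u v * e s" for s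
    proof -
      have "q s * Y u s - q s * Y v s = q s * (apply_bcontfun u s - apply_bcontfun v s) * e s"
        by (simp add: Y_def algebra_simps)
      also have "norm \<dots> = norm (q s) * dist (apply_bcontfun u s) (apply_bcontfun v s) * e s"
        using e(2)[of s] by (simp add: norm_mult dist_norm)
      also have "\<dots> \<le> K * dist u v * e s" using K K0 e(2)[of s] by (intro mult_mono dist_bounded) auto
      finally show ?thesis .
    qed
    then have "norm (W u s - W v s) \<le> K * dist u v / \<mu> * e s" for s
      unfolding e_def W_def using \<mu>
        is_primitive_add[OF W_prim[of u] is_primitive_cmult[OF W_prim[of v], of "-1"]]
      by (intro is_primitive_exp_bound[where f = "\<lambda>s. q s * Y u s - q s * Y v s"]) auto
    then have "norm (primitive_from a (W u) t - primitive_from a (W v) t) \<le> K * dist u v / \<mu> / \<mu> * e t"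
      unfolding e_def using \<mu>
        is_primitive_add[OF Z_prim[of u] is_primitive_cmult[OF Z_prim[of v], of "-1"]]
      by (intro is_primitive_exp_bound[where f = "\<lambda>s. W u s - W v s"
            and F = "\<lambda>t. primitive_from a (W u) t - primitive_from a (W v) t"]) auto
    then have "norm k * norm (primitive_from a (W u) t - primitive_from a (W v) t)
        \<le> norm k * (K * dist u v / \<mu> / \<mu> * e t)" by (intro mult_left_mono) auto
    also have "\<dots> = norm k * (K / \<mu> / \<mu>) * (dist u v * e t)" by simp
    also have "\<dots> \<le> 1 / 2 * (dist u v * e t)"
      using contraction e(2)[of t] by (intro mult_right_mono) auto
    finally show ?thesis by (simp add: Z_def norm_mult flip: right_diff_distrib)
  qed
  define \<Phi> where "\<Phi> u = Bcontfun (\<lambda>t. Z u t / complex_of_real (e t))" for u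
  have \<Phi>: "apply_bcontfun (\<Phi> u) t = Z u t / complex_of_real (e t)" for u t
  proof -
    obtain B where B: "\<And>s. norm (apply_bcontfun u s) \<le> B"
      using bounded_apply_bcontfun[of u] by (auto simp: bounded_iff)
    have "(\<lambda>t. Z u t / complex_of_real (e t)) \<in> bcontfun"
      unfolding bcontfun_def
    proof (intro CollectI conjI)
      show "continuous_on UNIV (\<lambda>t. Z u t / complex_of_real (e t))"
        using e(2) by (intro continuous_intros Z_cont e_cont) (auto simp: less_le)
      have "norm (Z u t / complex_of_real (e t)) \<le> norm y0 + norm k * ((norm w0 + K * B / \<mu>) / \<mu>)" for t
        using bZ[OF B, of t] e(2)[of t] by (simp add: norm_divide pos_divide_le_eq)
      then show "bounded (range (\<lambda>t. Z u t / complex_of_real (e t)))" by (auto simp: bounded_iff)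
    qed
    then show ?thesis by (simp add: \<Phi>_def Bcontfun_inverse)
  qed
  have "dist (\<Phi> u) (\<Phi> v) \<le> 1 / 2 * dist u v" for u v
  proof (rule dist_bound)
    fix t
    have "dist (apply_bcontfun (\<Phi> u) t) (apply_bcontfun (\<Phi> v) t) = norm (Z u t - Z v t) / e t"
      using e(2)[of t] by (simp add: \<Phi> dist_norm norm_divide flip: diff_divide_distrib)
    also have "\<dots> \<le> 1 / 2 * dist u v" using lip[of u t v] e(2)[of t] by (simp add: pos_divide_le_eq)
    finally show "dist (apply_bcontfun (\<Phi> u) t) (apply_bcontfun (\<Phi> v) t) \<le> 1 / 2 * dist u v" .
  qed
  then obtain u where u: "\<Phi> u = u" using banach_fix_type[of "1/2" \<Phi>] by auto
  have YZ: "Y u = Z u"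
  proof
    fix t show "Y u t = Z u t" using \<Phi>[of u t] u e(2)[of t] by (simp add: Y_def)
  qed
  show thesis
  proof (rule that[of "Y u" "W u"])
    show "is_primitive UNIV (Y u) (\<lambda>s. k * W u s)"
      using is_primitive_cmult[OF Z_prim[of u], of k] unfolding YZ Z_def by (simp add: is_primitive_def)
    show "is_primitive UNIV (W u) (\<lambda>s. q s * Y u s)"
      using W_prim[of u] unfolding W_def by (simp add: is_primitive_def)
    show "Y u a = y0" by (simp add: YZ Z_def)
    show "W u a = w0" by (simp add: W_def)
  qed
qed

section \<open>The linear system in homogeneous coordinates\<close>

text \<open>
  The equation \<open>y'' = - \<kappa>\<^sup>2 \<epsilon> y\<close> in the unknowns \<open>y\<close> and \<open>w = y' / (\<i> \<kappa>)\<close>. With this scaling the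
  state of the control system is the quotient \<open>w / y\<close>.
\<close>

definition lin_sol ::
    "complex \<Rightarrow> (real \<Rightarrow> real) \<Rightarrow> real set \<Rightarrow> (real \<Rightarrow> complex) \<Rightarrow> (real \<Rightarrow> complex) \<Rightarrow> bool" where
  "lin_sol \<kappa> \<epsilon> S y w \<longleftrightarrow> is_primitive S y (\<lambda>s. \<i> * \<kappa> * w s) \<and>
     is_primitive S w (\<lambda>s. \<i> * \<kappa> * of_real (\<epsilon> s) * y s)"

text \<open>
  \<open>w\<close> and \<open>y\<close> as homogeneous coordinates \<open>[w : y]\<close> of a point of the sphere. The relation is linear in
  \<open>(y, w)\<close>, and the pair \<open>(0, 0)\<close> represents every point.
\<close>

definition represents :: "complex option \<Rightarrow> complex \<Rightarrow> complex \<Rightarrow> bool" where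
  "represents \<eta> y w \<longleftrightarrow> (case \<eta> of None \<Rightarrow> y = 0 | Some z \<Rightarrow> w = z * y)"

text \<open>
  Everywhere bounded, rather than almost everywhere: solutions are compared by pointwise estimates.
\<close>

definition bdd_coeff :: "(real \<Rightarrow> real) \<Rightarrow> bool" where
  "bdd_coeff \<epsilon> \<longleftrightarrow> \<epsilon> \<in> borel_measurable lebesgue \<and> (\<exists>B. \<forall>s. \<bar>\<epsilon> s\<bar> \<le> B)"

text \<open>
  The notion through which modes and controls are compared: both the existence of a mode and the
  steering of the control system amount to it. It depends on \<open>\<epsilon>\<close> only up to null sets of \<open>[a, b]\<close> and
  is covariant under translations.
\<close>

definition transfers ::
    "complex \<Rightarrow> (real \<Rightarrow> real) \<Rightarrow> real \<Rightarrow> real \<Rightarrow> complex option \<Rightarrow> complex option \<Rightarrow> bool" where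
  "transfers \<kappa> \<epsilon> a b \<eta> \<eta>' \<longleftrightarrow>
     (\<exists>y w. lin_sol \<kappa> \<epsilon> {a..b} y w \<and> (y a, w a) \<noteq> (0, 0) \<and>
        represents \<eta> (y a) (w a) \<and> represents \<eta>' (y b) (w b))"

lemma represents_None [simp]: "represents None y w \<longleftrightarrow> y = 0"
  and represents_Some [simp]: "represents (Some z) y w \<longleftrightarrow> w = z * y"
  by (auto simp: represents_def)

text \<open>
  In the chart \<open>-1/x\<close> the incidence relation is again linear; the value at \<open>x = 0\<close> is the only one where
  the chart does not describe the point.
\<close>

lemma represents_chart_at_inf:
  "\<eta> \<noteq> Some 0 \<Longrightarrow> represents \<eta> y w \<longleftrightarrow> y + chart_at_inf \<eta> * w = 0"
  by (cases \<eta>) (auto simp: chart_at_inf_def field_simps)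

lemma lin_sol_subset: "lin_sol \<kappa> \<epsilon> S y w \<Longrightarrow> S' \<subseteq> S \<Longrightarrow> lin_sol \<kappa> \<epsilon> S' y w"
  unfolding lin_sol_def using is_primitive_subset by blast

lemma lin_sol_AE_cong:
  assumes "AE s\<in>S in lebesgue. \<epsilon> s = \<epsilon>' s"
  shows "lin_sol \<kappa> \<epsilon> S y w \<longleftrightarrow> lin_sol \<kappa> \<epsilon>' S y w"
proof -
  have "AE s\<in>S in lebesgue. \<i> * \<kappa> * of_real (\<epsilon> s) * y s = \<i> * \<kappa> * of_real (\<epsilon>' s) * y s"
    using assms by eventually_elim auto
  from is_primitive_AE_cong[OF this] show ?thesis unfolding lin_sol_def by simp
qed

lemma transfers_AE_cong:
  assumes "AE s\<in>{a..b} in lebesgue. \<epsilon> s = \<epsilon>' s"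
  shows "transfers \<kappa> \<epsilon> a b \<eta> \<eta>' \<longleftrightarrow> transfers \<kappa> \<epsilon>' a b \<eta> \<eta>'"
  unfolding transfers_def using lin_sol_AE_cong[OF assms] by simp

lemma transfers_shift_imp:
  assumes "transfers \<kappa> \<epsilon> (a + h) (b + h) \<eta> \<eta>'"
  shows "transfers \<kappa> (\<lambda>s. \<epsilon> (s + h)) a b \<eta> \<eta>'"
proof -
  obtain y w where yw: "lin_sol \<kappa> \<epsilon> {a + h..b + h} y w" "(y (a + h), w (a + h)) \<noteq> (0, 0)"
    "represents \<eta> (y (a + h)) (w (a + h))" "represents \<eta>' (y (b + h)) (w (b + h))"
    using assms unfolding transfers_def by blast
  have "lin_sol \<kappa> (\<lambda>s. \<epsilon> (s + h)) {a..b} (\<lambda>s. y (s + h)) (\<lambda>s. w (s + h))"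
    using yw(1) is_primitive_shift[of a h b y] is_primitive_shift[of a h b w]
    unfolding lin_sol_def by blast
  then show ?thesis unfolding transfers_def using yw(2-) by blast
qed

lemma transfers_shift:
  "transfers \<kappa> (\<lambda>s. \<epsilon> (s + h)) a b \<eta> \<eta>' \<longleftrightarrow> transfers \<kappa> \<epsilon> (a + h) (b + h) \<eta> \<eta>'"
  using transfers_shift_imp[of \<kappa> \<epsilon> a h b \<eta> \<eta>']
    transfers_shift_imp[of \<kappa> "\<lambda>s. \<epsilon> (s + h)" "a + h" "- h" "b + h" \<eta> \<eta>'] by auto

lemma lin_sol_continuous_on:
  assumes "lin_sol \<kappa> \<epsilon> {a..b} y w"
  shows "continuous_on {a..b} y" "continuous_on {a..b} w"
  using assms unfolding lin_sol_def by (auto intro: is_primitive_continuous_on)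

lemma lin_sol_exists:
  assumes "bdd_coeff \<epsilon>"
  obtains y w where "lin_sol \<kappa> \<epsilon> UNIV y w" "y a = y0" "w a = w0"
proof -
  obtain B where B: "\<And>s. \<bar>\<epsilon> s\<bar> \<le> B" and meas: "\<epsilon> \<in> borel_measurable lebesgue"
    using assms by (auto simp: bdd_coeff_def)
  let ?q = "\<lambda>s. \<i> * \<kappa> * complex_of_real (\<epsilon> s)"
  have bound: "norm (?q s) \<le> norm \<kappa> * B" for s
    using B[of s] by (auto simp: norm_mult intro: mult_left_mono)
  have "?q integrable_on {c..d}" for c d
  proof (rule measurable_bounded_by_integrable_imp_integrable[where g = "\<lambda>_. norm \<kappa> * B"])
    have "?q \<in> borel_measurable lebesgue" using meas by measurable
    then show "?q \<in> borel_measurable (lebesgue_on {c..d})" by (rule measurable_restrict_space1)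
  qed (use bound in auto)
  from linear_system_exists[OF this bound, of "\<i> * \<kappa>" a y0 w0] that show thesis
    unfolding lin_sol_def by blast
qed

lemma has_integral_Pair:
  fixes f g :: "real \<Rightarrow> complex"
  assumes "(f has_integral I) S" "(g has_integral J) S"
  shows "((\<lambda>s. (f s, g s)) has_integral (I, J)) S"
proof -
  have "bounded_linear (\<lambda>x::complex. (x, 0::complex))" "bounded_linear (\<lambda>x::complex. (0::complex, x))"
    by (intro bounded_linear_Pair bounded_linear_ident bounded_linear_zero)+
  from has_integral_add[OF has_integral_linear[OF assms(1) this(1)] has_integral_linear[OF assms(2) this(2)]]
  show ?thesis by (simp add: o_def)
qed

text \<open>
  The two components are treated as one vector, since neither of them alone controls its own derivative.
\<close>

lemma lin_sol_zero:
  assumes sol: "lin_sol \<kappa> \<epsilon> {a..b} y w" and bdd: "bdd_coeff \<epsilon>"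
    and p: "p \<in> {a..b}" "y p = 0" "w p = 0" and q: "q \<in> {a..b}"
  shows "y q = 0 \<and> w q = 0"
proof -
  obtain B where B: "\<And>s. \<bar>\<epsilon> s\<bar> \<le> B" using bdd by (auto simp: bdd_coeff_def)
  have B0: "0 \<le> B" using order_trans[OF abs_ge_zero B] .
  have "(\<lambda>s. (y s, w s)) q = 0"
  proof (rule primitive_zero_propagates[where a = a and b = b and p = p and K = "norm \<kappa> * (1 + B)"
        and f = "\<lambda>s. (\<i> * \<kappa> * w s, \<i> * \<kappa> * of_real (\<epsilon> s) * y s)"])
    fix c d assume cd: "a \<le> c" "c \<le> d" "d \<le> b"
    have "((\<lambda>s. (\<i> * \<kappa> * w s, \<i> * \<kappa> * of_real (\<epsilon> s) * y s)) has_integral (y d - y c, w d - w c)) {c..d}"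
      using sol cd unfolding lin_sol_def by (intro has_integral_Pair is_primitiveD) auto
    then show "((\<lambda>s. (\<i> * \<kappa> * w s, \<i> * \<kappa> * of_real (\<epsilon> s) * y s)) has_integral (y d, w d) - (y c, w c)) {c..d}"
      by simp
  next
    fix s
    have "norm (\<i> * \<kappa> * w s, \<i> * \<kappa> * of_real (\<epsilon> s) * y s)
        \<le> norm (\<i> * \<kappa> * w s) + norm (\<i> * \<kappa> * of_real (\<epsilon> s) * y s)" by (rule norm_Pair_le)
    also have "\<dots> = norm \<kappa> * (norm (w s) + \<bar>\<epsilon> s\<bar> * norm (y s))" by (simp add: norm_mult algebra_simps)
    also have "\<dots> \<le> norm \<kappa> * (norm (y s, w s) + B * norm (y s, w s))"
      using B[of s] B0 norm_fst_le[of "y s" "w s"] norm_snd_le[of "w s" "y s"]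
      by (intro mult_left_mono add_mono mult_mono) auto
    finally show "norm (\<i> * \<kappa> * w s, \<i> * \<kappa> * of_real (\<epsilon> s) * y s) \<le> norm \<kappa> * (1 + B) * norm (y s, w s)"
      by (simp add: algebra_simps)
  qed (use p q in \<open>auto simp: zero_prod_def\<close>)
  then show ?thesis by (simp add: zero_prod_def)
qed

lemma lin_sol_diff:
  assumes "lin_sol \<kappa> \<epsilon> S y w" "lin_sol \<kappa> \<epsilon> S y' w'"
  shows "lin_sol \<kappa> \<epsilon> S (\<lambda>s. y s - y' s) (\<lambda>s. w s - w' s)"
proof -
  have 1: "is_primitive S y (\<lambda>s. \<i> * \<kappa> * w s)" "is_primitive S w (\<lambda>s. \<i> * \<kappa> * of_real (\<epsilon> s) * y s)"
    and 2: "is_primitive S y' (\<lambda>s. \<i> * \<kappa> * w' s)" "is_primitive S w' (\<lambda>s. \<i> * \<kappa> * of_real (\<epsilon> s) * y' s)"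
    using assms by (auto simp: lin_sol_def)
  show ?thesis unfolding lin_sol_def
    using is_primitive_add[OF 1(1) is_primitive_cmult[OF 2(1), of "-1"]]
      is_primitive_add[OF 1(2) is_primitive_cmult[OF 2(2), of "-1"]]
    by (simp add: algebra_simps)
qed

lemma lin_sol_unique:
  assumes "lin_sol \<kappa> \<epsilon> {a..b} y w" "lin_sol \<kappa> \<epsilon> {a..b} y' w'" "bdd_coeff \<epsilon>"
    and "p \<in> {a..b}" "y p = y' p" "w p = w' p" and "q \<in> {a..b}"
  shows "y q = y' q \<and> w q = w' q"
  using lin_sol_zero[OF lin_sol_diff[OF assms(1,2)] assms(3,4) _ _ assms(7)] assms(5,6) by simp

lemma transfers_global:
  assumes "transfers \<kappa> \<epsilon> a b \<eta> \<eta>'" "bdd_coeff \<epsilon>" "a \<le> b"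
  obtains y w where "lin_sol \<kappa> \<epsilon> UNIV y w" "(y a, w a) \<noteq> (0, 0)"
    "represents \<eta> (y a) (w a)" "represents \<eta>' (y b) (w b)"
proof -
  obtain y' w' where yw': "lin_sol \<kappa> \<epsilon> {a..b} y' w'" "(y' a, w' a) \<noteq> (0, 0)"
    "represents \<eta> (y' a) (w' a)" "represents \<eta>' (y' b) (w' b)"
    using assms(1) unfolding transfers_def by blast
  obtain y w where yw: "lin_sol \<kappa> \<epsilon> UNIV y w" "y a = y' a" "w a = w' a"
    using lin_sol_exists[OF assms(2)] by blast
  have "y b = y' b \<and> w b = w' b"
    using lin_sol_unique[OF lin_sol_subset[OF yw(1)] yw'(1) assms(2), of a b] yw assms(3) by auto
  then show thesis using that[OF yw(1)] yw yw' by simp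
qed

section \<open>The control system as the projectivised linear system\<close>

lemma is_primitive_zero_propagates:
  assumes "is_primitive {a..b} W (\<lambda>s. g s * W s)" and "\<And>s. s \<in> {a..b} \<Longrightarrow> norm (g s) \<le> K"
    and "p \<in> {a..b}" "W p = 0" "q \<in> {a..b}"
  shows "W q = 0"
proof (rule primitive_zero_propagates[where f = "\<lambda>s. g s * W s" and K = K and u = W and p = p])
  show "((\<lambda>s. g s * W s) has_integral W d - W c) {c..d}" if "a \<le> c" "c \<le> d" "d \<le> b" for c d
    using that by (intro is_primitiveD[OF assms(1)]) auto
qed (use assms(2-) in \<open>auto intro!: mult_right_mono simp: norm_mult\<close>)

text \<open>
  If \<open>X\<close> solves \<open>X' = \<i> \<kappa> (- X\<^sup>2 + \<epsilon>)\<close> and \<open>(y, w)\<close> solves the linear system, then the defect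
  \<open>D = X y - w\<close> satisfies the homogeneous linear equation \<open>D' = - \<i> \<kappa> X D\<close>. So if \<open>X = w / y\<close> holds
  at one point, it holds on the interval, also across zeros of \<open>y\<close>.
\<close>

lemma Riccati_represents:
  assumes sol: "lin_sol \<kappa> \<epsilon> {a..b} y w" and bdd: "bdd_coeff \<epsilon>"
    and X: "is_primitive {a..b} X (\<lambda>s. \<i> * \<kappa> * (- (X s)\<^sup>2 + of_real (\<epsilon> s)))"
    and p: "p \<in> {a..b}" "w p = X p * y p" and q: "q \<in> {a..b}"
  shows "w q = X q * y q"
proof -
  obtain B where B: "\<And>s. \<bar>\<epsilon> s\<bar> \<le> B" using bdd by (auto simp: bdd_coeff_def)
  have y: "is_primitive {a..b} y (\<lambda>s. \<i> * \<kappa> * w s)"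
    and w: "is_primitive {a..b} w (\<lambda>s. \<i> * \<kappa> * of_real (\<epsilon> s) * y s)"
    using sol by (auto simp: lin_sol_def)
  obtain MX where MX: "MX > 0" "\<And>s. s \<in> {a..b} \<Longrightarrow> norm (X s) \<le> MX"
    using bounded_on_Icc[OF is_primitive_continuous_on[OF X order_refl]] by blast
  obtain Mw where Mw: "Mw > 0" "\<And>s. s \<in> {a..b} \<Longrightarrow> norm (w s) \<le> Mw"
    using bounded_on_Icc[OF lin_sol_continuous_on(2)[OF sol]] by blast
  have bX: "norm (\<i> * \<kappa> * (- (X s)\<^sup>2 + of_real (\<epsilon> s))) \<le> norm \<kappa> * (MX\<^sup>2 + B)" if "s \<in> {a..b}" for s
  proof -
    have "norm (- (X s)\<^sup>2 + of_real (\<epsilon> s)) \<le> norm (X s)^2 + \<bar>\<epsilon> s\<bar>"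
      using norm_triangle_ineq[of "- (X s)\<^sup>2" "of_real (\<epsilon> s)"] by (simp add: norm_power)
    also have "\<dots> \<le> MX\<^sup>2 + B" using MX(2)[OF that] B by (intro add_mono power_mono) auto
    finally show ?thesis by (simp add: norm_mult mult_left_mono)
  qed
  have bdw: "norm (\<i> * \<kappa> * w s) \<le> norm \<kappa> * Mw" if "s \<in> {a..b}" for s
    using Mw(2)[OF that] by (simp add: norm_mult mult_left_mono)
  have "is_primitive {a..b} (\<lambda>s. X s * y s + - 1 * w s)
      (\<lambda>s. (\<i> * \<kappa> * (- (X s)\<^sup>2 + of_real (\<epsilon> s)) * y s + \<i> * \<kappa> * w s * X s)
        + - 1 * (\<i> * \<kappa> * of_real (\<epsilon> s) * y s))"
    by (intro is_primitive_add is_primitive_cmult is_primitive_mult[OF X bX y bdw] w)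
  then have "is_primitive {a..b} (\<lambda>s. X s * y s + - 1 * w s) (\<lambda>s. (- \<i> * \<kappa> * X s) * (X s * y s + - 1 * w s))"
    by (simp add: algebra_simps power2_eq_square)
  then have "X q * y q + - 1 * w q = 0"
    by (rule is_primitive_zero_propagates[where K = "norm \<kappa> * MX"])
      (use p q MX in \<open>auto simp: norm_mult mult_left_mono\<close>)
  then show ?thesis by simp
qed

text \<open>
  The same in the chart at infinity: the defect \<open>D = y + X w\<close> satisfies \<open>D' = \<i> \<kappa> \<epsilon> X D\<close>.
\<close>

lemma Riccati_at_inf_represents:
  assumes sol: "lin_sol \<kappa> \<epsilon> {a..b} y w" and bdd: "bdd_coeff \<epsilon>"
    and X: "is_primitive {a..b} X (\<lambda>s. \<i> * \<kappa> * (- 1 + of_real (\<epsilon> s) * (X s)\<^sup>2))"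
    and p: "p \<in> {a..b}" "y p + X p * w p = 0" and q: "q \<in> {a..b}"
  shows "y q + X q * w q = 0"
proof -
  obtain B where B: "\<And>s. \<bar>\<epsilon> s\<bar> \<le> B" using bdd by (auto simp: bdd_coeff_def)
  have B0: "0 \<le> B" using order_trans[OF abs_ge_zero B] .
  have y: "is_primitive {a..b} y (\<lambda>s. \<i> * \<kappa> * w s)"
    and w: "is_primitive {a..b} w (\<lambda>s. \<i> * \<kappa> * of_real (\<epsilon> s) * y s)"
    using sol by (auto simp: lin_sol_def)
  obtain MX where MX: "MX > 0" "\<And>s. s \<in> {a..b} \<Longrightarrow> norm (X s) \<le> MX"
    using bounded_on_Icc[OF is_primitive_continuous_on[OF X order_refl]] by blast
  obtain My where My: "My > 0" "\<And>s. s \<in> {a..b} \<Longrightarrow> norm (y s) \<le> My"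
    using bounded_on_Icc[OF lin_sol_continuous_on(1)[OF sol]] by blast
  have bX: "norm (\<i> * \<kappa> * (- 1 + of_real (\<epsilon> s) * (X s)\<^sup>2)) \<le> norm \<kappa> * (1 + B * MX\<^sup>2)" if "s \<in> {a..b}" for s
  proof -
    have "norm (- 1 + of_real (\<epsilon> s) * (X s)\<^sup>2) \<le> 1 + \<bar>\<epsilon> s\<bar> * norm (X s)^2"
      using norm_triangle_ineq[of "- 1" "of_real (\<epsilon> s) * (X s)\<^sup>2"] by (simp add: norm_power norm_mult)
    also have "\<dots> \<le> 1 + B * MX\<^sup>2" using MX(2)[OF that] B B0 by (intro add_mono mult_mono power_mono) auto
    finally show ?thesis by (simp add: norm_mult mult_left_mono)
  qed
  have bdw: "norm (\<i> * \<kappa> * of_real (\<epsilon> s) * y s) \<le> norm \<kappa> * (B * My)" if "s \<in> {a..b}" for s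
    using My(2)[OF that] B[of s] B0 by (simp add: norm_mult mult.assoc) (intro mult_left_mono mult_mono, auto)
  have "is_primitive {a..b} (\<lambda>s. y s + X s * w s)
      (\<lambda>s. \<i> * \<kappa> * w s + (\<i> * \<kappa> * (- 1 + of_real (\<epsilon> s) * (X s)\<^sup>2) * w s + \<i> * \<kappa> * of_real (\<epsilon> s) * y s * X s))"
    by (intro is_primitive_add is_primitive_mult[OF X bX w bdw] y)
  then have "is_primitive {a..b} (\<lambda>s. y s + X s * w s)
      (\<lambda>s. (\<i> * \<kappa> * of_real (\<epsilon> s) * X s) * (y s + X s * w s))"
    by (simp add: algebra_simps power2_eq_square)
  then show ?thesis
  proof (rule is_primitive_zero_propagates[where K = "norm \<kappa> * (B * MX)"])
    fix s assume "s \<in> {a..b}"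
    then show "norm (\<i> * \<kappa> * of_real (\<epsilon> s) * X s) \<le> norm \<kappa> * (B * MX)"
      using MX(2) B[of s] B0 by (simp add: norm_mult mult.assoc) (intro mult_left_mono mult_mono, auto)
  qed (use p q in auto)
qed

lemma mem_insert_None_image_Some: "v \<in> insert None (Some ` (UNIV - K)) \<longleftrightarrow> v \<notin> Some ` K"
  by (cases v) auto

text \<open>
  Each time has a neighbourhood on which the state stays in one of the two charts, and there the
  incidence between the state and the linear solution propagates. By compactness of \<open>[a, b]\<close> it
  propagates from \<open>a\<close> to \<open>b\<close>. In particular the trajectory is determined by its initial state.
\<close>

lemma trajectory_represents:
  assumes traj: "trajectory \<kappa> \<epsilon> a b x" and ab: "a \<le> b" and bdd: "bdd_coeff \<epsilon>"
    and sol: "lin_sol \<kappa> \<epsilon> {a..b} y w" and init: "represents (x a) (y a) (w a)"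
  shows "represents (x b) (y b) (w b)"
proof -
  have cont: "continuous_map (top_of_set {a..b}) sphere_top x"
    and fin: "is_primitive {s\<in>{a..b}. x s \<noteq> None} (\<lambda>s. the (x s))
       (\<lambda>s. \<i> * \<kappa> * (- (the (x s))\<^sup>2 + of_real (\<epsilon> s)))"
    and inf: "is_primitive {s\<in>{a..b}. x s \<noteq> Some 0} (\<lambda>s. chart_at_inf (x s))
       (\<lambda>s. \<i> * \<kappa> * (- 1 + of_real (\<epsilon> s) * (chart_at_inf (x s))\<^sup>2))"
    using traj by (auto simp: trajectory_def)
  have op: "openin (top_of_set {a..b}) {s\<in>{a..b}. x s \<noteq> None}"
    "openin (top_of_set {a..b}) {s\<in>{a..b}. x s \<noteq> Some 0}"
  proof -
    have "openin sphere_top (range Some :: complex option set)" by simp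
    from openin_continuous_map_preimage[OF cont this]
    show "openin (top_of_set {a..b}) {s\<in>{a..b}. x s \<noteq> None}"
      by (auto simp: notin_range_Some elim!: back_subst[where P = "openin _"])
    have "openin sphere_top (insert None (Some ` (UNIV - {0::complex})))"
      unfolding openin_Alexandroff_compactification by (intro disjI2 exI[of _ "{0}"]) auto
    from openin_continuous_map_preimage[OF cont this]
    show "openin (top_of_set {a..b}) {s\<in>{a..b}. x s \<noteq> Some 0}"
      unfolding mem_insert_None_image_Some by (auto elim!: back_subst[where P = "openin _"])
  qed
  define R where "R s \<longleftrightarrow> represents (x s) (y s) (w s)" for s
  have step: "R s \<Longrightarrow> R t"
    if st: "a \<le> s" "s \<le> t" "t \<le> b"
      and sub: "{s..t} \<subseteq> {s\<in>{a..b}. x s \<noteq> None} \<or> {s..t} \<subseteq> {s\<in>{a..b}. x s \<noteq> Some 0}" for s t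
  proof -
    assume R: "R s"
    have sol': "lin_sol \<kappa> \<epsilon> {s..t} y w" using st by (intro lin_sol_subset[OF sol]) auto
    from sub show "R t"
    proof
      assume sub: "{s..t} \<subseteq> {s\<in>{a..b}. x s \<noteq> None}"
      have "x s \<noteq> None" "x t \<noteq> None" using sub st by (force simp: subset_iff)+
      then show "R t" using R st
          Riccati_represents[OF sol' bdd is_primitive_subset[OF fin sub], of s t]
        by (auto simp: R_def)
    next
      assume sub: "{s..t} \<subseteq> {s\<in>{a..b}. x s \<noteq> Some 0}"
      have "x s \<noteq> Some 0" "x t \<noteq> Some 0" using sub st by (force simp: subset_iff)+
      then show "R t" using R st
          Riccati_at_inf_represents[OF sol' bdd is_primitive_subset[OF inf sub], of s t]
        by (auto simp: R_def represents_chart_at_inf)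
    qed
  qed
  have "a \<le> a \<longrightarrow> b \<le> b \<longrightarrow> R a \<longrightarrow> R b"
  proof (rule Bolzano[where P = "\<lambda>s t. a \<le> s \<longrightarrow> t \<le> b \<longrightarrow> R s \<longrightarrow> R t", OF ab])
    fix r assume r: "a \<le> r" "r \<le> b"
    define U where "U = (if x r = None then {s\<in>{a..b}. x s \<noteq> Some 0} else {s\<in>{a..b}. x s \<noteq> None})"
    have U: "r \<in> U" "openin (top_of_set {a..b}) U"
      "U = {s\<in>{a..b}. x s \<noteq> None} \<or> U = {s\<in>{a..b}. x s \<noteq> Some 0}"
      using op r by (auto simp: U_def)
    then have "\<exists>\<delta>>0. \<forall>s\<in>{a..b}. dist s r < \<delta> \<longrightarrow> s \<in> U"
      by (simp add: openin_euclidean_subtopology_iff)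
    then obtain \<delta> where \<delta>: "\<delta> > 0" "\<And>s. s \<in> {a..b} \<Longrightarrow> dist s r < \<delta> \<Longrightarrow> s \<in> U" by blast
    show "\<exists>\<delta>>0. \<forall>s t. s \<le> r \<and> r \<le> t \<and> t - s < \<delta> \<longrightarrow> a \<le> s \<longrightarrow> t \<le> b \<longrightarrow> R s \<longrightarrow> R t"
    proof (intro exI[of _ \<delta>] conjI allI impI \<delta>(1))
      fix s t assume st: "s \<le> r \<and> r \<le> t \<and> t - s < \<delta>" "a \<le> s" "t \<le> b" and R: "R s"
      have "{s..t} \<subseteq> U" using st by (auto intro!: \<delta>(2) simp: dist_real_def)
      then show "R t" using step[of s t] st R U(3) by auto
    qed
  qed auto
  then show ?thesis using init by (simp add: R_def)
qed

definition quotient_state :: "complex \<Rightarrow> complex \<Rightarrow> complex option" where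
  "quotient_state y w = (if y = 0 then None else Some (w / y))"

lemma represents_quotient_state:
  "(y, w) \<noteq> (0, 0) \<Longrightarrow> represents \<eta> y w \<longleftrightarrow> \<eta> = quotient_state y w"
  by (cases \<eta>) (auto simp: quotient_state_def field_simps)

text \<open>
  Only the zeros of \<open>y\<close> are critical. A neighbourhood of \<open>\<infinity>\<close> is the complement of a compact \<open>K\<close>, and
  the preimage of \<open>K\<close> is the projection, along \<open>K\<close>, of the closed set \<open>{(z, s). w s = z * y s}\<close>;
  hence it is closed.
\<close>

lemma continuous_map_quotient_state:
  fixes y w :: "real \<Rightarrow> complex"
  assumes y: "continuous_on {a..b} y" and w: "continuous_on {a..b} w"
    and nz: "\<And>s. s \<in> {a..b} \<Longrightarrow> (y s, w s) \<noteq> (0, 0)"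
  shows "continuous_map (top_of_set {a..b}) sphere_top (\<lambda>s. quotient_state (y s) (w s))"
proof -
  let ?x = "\<lambda>s. quotient_state (y s) (w s)"
  have cl: "closedin (top_of_set {a..b}) {s\<in>{a..b}. ?x s \<in> Some ` K}" if K: "compact K" for K
  proof -
    have "closed {u \<in> UNIV \<times> {a..b}. w (snd u) - fst u * y (snd u) = 0}"
      by (intro continuous_closed_preimage_constant continuous_intros closed_Times closed_UNIV
          closed_atLeastAtMost continuous_on_compose2[OF y] continuous_on_compose2[OF w]) auto
    from closed_compact_projection[OF K this]
    have "closed {s. \<exists>z. z \<in> K \<and> s \<in> {a..b} \<and> w s = z * y s}" by (simp add: conj_commute)
    moreover have "{s\<in>{a..b}. ?x s \<in> Some ` K} = {s. \<exists>z. z \<in> K \<and> s \<in> {a..b} \<and> w s = z * y s}"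
      using nz represents_quotient_state[OF nz, of _ "Some _"] by (auto simp: image_iff) metis+
    ultimately show ?thesis by (intro closed_subset) auto
  qed
  have op: "openin (top_of_set {a..b}) {s\<in>{a..b}. ?x s \<in> Some ` U}" if U: "open U" for U
  proof -
    let ?S = "{a..b} \<inter> y -` (- {0})"
    have S: "openin (top_of_set {a..b}) ?S" using y by (intro continuous_openin_preimage_gen) auto
    have "continuous_on ?S (\<lambda>s. w s / y s)"
      by (intro continuous_intros continuous_on_subset[OF y] continuous_on_subset[OF w]) auto
    from openin_trans[OF continuous_openin_preimage_gen[OF this U] S]
    have "openin (top_of_set {a..b}) (?S \<inter> (\<lambda>s. w s / y s) -` U)" .
    moreover have "?S \<inter> (\<lambda>s. w s / y s) -` U = {s\<in>{a..b}. ?x s \<in> Some ` U}"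
      by (auto simp: quotient_state_def image_iff)
    ultimately show ?thesis by simp
  qed
  show ?thesis unfolding continuous_map_def
  proof (intro conjI allI impI)
    fix V :: "complex option set"
    assume "openin sphere_top V"
    then consider U where "open U" "V = Some ` U" | K where "compact K" "V = insert None (Some ` (UNIV - K))"
      by (auto simp: openin_Alexandroff_compactification)
    then show "openin (top_of_set {a..b}) {s \<in> topspace (top_of_set {a..b}). ?x s \<in> V}"
    proof cases
      case 1
      then show ?thesis using op by simp
    next
      case 2
      have "{s \<in> topspace (top_of_set {a..b}). ?x s \<in> V} = {a..b} - {s\<in>{a..b}. ?x s \<in> Some ` K}"
        unfolding 2(2) mem_insert_None_image_Some by auto
      then show ?thesis using cl[OF 2(1)] by (simp add: closedin_def)
    qed
  qed (auto simp: notin_range_Some)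
qed

text \<open>
  The converse of the incidence lemma: the quotient of a linear solution is a trajectory, by the quotient
  rule for \<open>w / y\<close> where \<open>y \<noteq> 0\<close> and for \<open>- y / w\<close> where \<open>w \<noteq> 0\<close>.
\<close>

lemma trajectory_quotient_state:
  assumes sol: "lin_sol \<kappa> \<epsilon> {a..b} y w" and bdd: "bdd_coeff \<epsilon>"
    and nz: "\<And>s. s \<in> {a..b} \<Longrightarrow> (y s, w s) \<noteq> (0, 0)"
  shows "trajectory \<kappa> \<epsilon> a b (\<lambda>s. quotient_state (y s) (w s))"
proof -
  let ?x = "\<lambda>s. quotient_state (y s) (w s)"
  obtain B where B: "\<And>s. \<bar>\<epsilon> s\<bar> \<le> B" using bdd by (auto simp: bdd_coeff_def)
  have B0: "0 \<le> B" using order_trans[OF abs_ge_zero B] .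
  obtain My where My: "My > 0" "\<And>s. s \<in> {a..b} \<Longrightarrow> norm (y s) \<le> My"
    using bounded_on_Icc[OF lin_sol_continuous_on(1)[OF sol]] by blast
  obtain Mw where Mw: "Mw > 0" "\<And>s. s \<in> {a..b} \<Longrightarrow> norm (w s) \<le> Mw"
    using bounded_on_Icc[OF lin_sol_continuous_on(2)[OF sol]] by blast
  have bdy: "norm (\<i> * \<kappa> * w s) \<le> norm \<kappa> * Mw" if "s \<in> {a..b}" for s
    using Mw(2)[OF that] by (simp add: norm_mult mult_left_mono)
  have bdw: "norm (\<i> * \<kappa> * of_real (\<epsilon> s) * y s) \<le> norm \<kappa> * (B * My)" if "s \<in> {a..b}" for s
    using My(2)[OF that] B[of s] B0 by (simp add: norm_mult mult.assoc) (intro mult_left_mono mult_mono, auto)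
  have main: "is_primitive {c..d} (\<lambda>s. the (?x s)) (\<lambda>s. \<i> * \<kappa> * (- (the (?x s))\<^sup>2 + of_real (\<epsilon> s)))"
    if sub: "{c..d} \<subseteq> {s\<in>{a..b}. ?x s \<noteq> None}" for c d
  proof -
    have ab: "s \<in> {a..b}" and y0: "y s \<noteq> 0" if "s \<in> {c..d}" for s
      using subsetD[OF sub that] by (auto simp: quotient_state_def split: if_splits)
    have sub': "{c..d} \<subseteq> {a..b}" using ab by blast
    have y: "is_primitive {c..d} y (\<lambda>s. \<i> * \<kappa> * w s)"
      and w: "is_primitive {c..d} w (\<lambda>s. \<i> * \<kappa> * of_real (\<epsilon> s) * y s)"
      using lin_sol_subset[OF sol sub'] by (auto simp: lin_sol_def)
    have "continuous_on {c..d} (\<lambda>s. - (\<i> * \<kappa> * w s * (inverse (y s))\<^sup>2))"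
      by (intro continuous_intros is_primitive_continuous_on[OF y] is_primitive_continuous_on[OF w]) (use y0 in auto)
    then obtain M where M: "\<And>s. s \<in> {c..d} \<Longrightarrow> norm (- (\<i> * \<kappa> * w s * (inverse (y s))\<^sup>2)) \<le> M"
      using bounded_on_Icc by blast
    have "is_primitive {c..d} (\<lambda>s. w s * inverse (y s))
       (\<lambda>s. \<i> * \<kappa> * of_real (\<epsilon> s) * y s * inverse (y s) + - (\<i> * \<kappa> * w s * (inverse (y s))\<^sup>2) * w s)"
      using ab by (intro is_primitive_mult[OF w bdw is_primitive_inverse[OF y bdy y0] M]) auto
    then show ?thesis
      by (rule iffD1[OF is_primitive_cong, rotated -1])
        (use y0 in \<open>auto simp: quotient_state_def field_simps power2_eq_square\<close>)
  qed
  have main_inf: "is_primitive {c..d} (\<lambda>s. chart_at_inf (?x s))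
      (\<lambda>s. \<i> * \<kappa> * (- 1 + of_real (\<epsilon> s) * (chart_at_inf (?x s))\<^sup>2))"
    if sub: "{c..d} \<subseteq> {s\<in>{a..b}. ?x s \<noteq> Some 0}" for c d
  proof -
    have ab: "s \<in> {a..b}" and w0: "w s \<noteq> 0" if "s \<in> {c..d}" for s
      using subsetD[OF sub that] nz[of s] by (auto simp: quotient_state_def split: if_splits)
    have sub': "{c..d} \<subseteq> {a..b}" using ab by blast
    have y: "is_primitive {c..d} y (\<lambda>s. \<i> * \<kappa> * w s)"
      and w: "is_primitive {c..d} w (\<lambda>s. \<i> * \<kappa> * of_real (\<epsilon> s) * y s)"
      using lin_sol_subset[OF sol sub'] by (auto simp: lin_sol_def)
    have chart: "chart_at_inf (?x s) = - (y s * inverse (w s))" if "s \<in> {c..d}" for s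
      using w0[OF that] by (auto simp: quotient_state_def chart_at_inf_def field_simps)
    have "continuous_on {c..d} (\<lambda>s. inverse (w s))"
      by (intro continuous_intros is_primitive_continuous_on[OF w]) (use w0 in auto)
    then obtain M where M: "M > 0" "\<And>s. s \<in> {c..d} \<Longrightarrow> norm (inverse (w s)) \<le> M"
      using bounded_on_Icc by blast
    have bi: "norm (- (\<i> * \<kappa> * of_real (\<epsilon> s) * y s * (inverse (w s))\<^sup>2)) \<le> norm \<kappa> * (B * My) * M\<^sup>2"
      if "s \<in> {c..d}" for s
      unfolding norm_minus_cancel norm_mult[of _ "(inverse (w s))\<^sup>2"] norm_power
      using bdw[OF ab[OF that]] M(2)[OF that] B0 My(1) by (intro mult_mono power_mono) auto
    have "is_primitive {c..d} (\<lambda>s. - 1 * (y s * inverse (w s)))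
       (\<lambda>s. - 1 * (\<i> * \<kappa> * w s * inverse (w s) + - (\<i> * \<kappa> * of_real (\<epsilon> s) * y s * (inverse (w s))\<^sup>2) * y s))"
      using ab by (intro is_primitive_cmult is_primitive_mult[OF y bdy is_primitive_inverse[OF w bdw w0] bi]) auto
    then show ?thesis
      by (rule iffD1[OF is_primitive_cong, rotated -1])
        (use w0 in \<open>auto simp: chart field_simps power2_eq_square\<close>)
  qed
  show ?thesis unfolding trajectory_def
    using continuous_map_quotient_state[OF lin_sol_continuous_on[OF sol] nz] main main_inf
    by (auto simp: is_primitive_def)
qed

lemma lin_sol_nonzero:
  assumes "lin_sol \<kappa> \<epsilon> {a..b} y w" "bdd_coeff \<epsilon>" "p \<in> {a..b}" "(y p, w p) \<noteq> (0, 0)" "q \<in> {a..b}"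
  shows "(y q, w q) \<noteq> (0, 0)"
  using lin_sol_zero[OF assms(1,2,5) _ _ assms(3)] assms(4) by auto

lemma trajectory_AE_cong:
  assumes "AE s\<in>{a..b} in lebesgue. \<epsilon> s = \<epsilon>' s"
  shows "trajectory \<kappa> \<epsilon> a b x \<longleftrightarrow> trajectory \<kappa> \<epsilon>' a b x"
proof -
  have "AE s\<in>{s\<in>{a..b}. x s \<noteq> None} in lebesgue.
      \<i> * \<kappa> * (- (the (x s))\<^sup>2 + of_real (\<epsilon> s)) = \<i> * \<kappa> * (- (the (x s))\<^sup>2 + of_real (\<epsilon>' s))"
    using assms by eventually_elim auto
  note 1 = is_primitive_AE_cong[OF this]
  have "AE s\<in>{s\<in>{a..b}. x s \<noteq> Some 0} in lebesgue.
      \<i> * \<kappa> * (- 1 + of_real (\<epsilon> s) * (chart_at_inf (x s))\<^sup>2) = \<i> * \<kappa> * (- 1 + of_real (\<epsilon>' s) * (chart_at_inf (x s))\<^sup>2)"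
    using assms by eventually_elim auto
  note 2 = is_primitive_AE_cong[OF this]
  show ?thesis unfolding trajectory_def 1 2 ..
qed

text \<open>
  The control system is the projectivisation of the linear system. From a trajectory, one
  takes the linear solution with the same initial point of the sphere and follows both; from a linear
  solution, one takes the quotient.
\<close>

lemma steers_iff_transfers:
  assumes bdd: "bdd_coeff \<epsilon>'" and AE: "AE s\<in>{a..a + t} in lebesgue. \<epsilon> s = \<epsilon>' s" and t: "0 \<le> t"
  shows "steers \<kappa> \<epsilon> a \<eta> \<eta>' t \<longleftrightarrow> transfers \<kappa> \<epsilon>' a (a + t) \<eta> \<eta>'"
proof
  assume "steers \<kappa> \<epsilon> a \<eta> \<eta>' t"
  then obtain x where x: "trajectory \<kappa> \<epsilon>' a (a + t) x" "x a = \<eta>" "x (a + t) = \<eta>'"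
    unfolding steers_def trajectory_AE_cong[OF AE] by blast
  \<comment> \<open>Homogeneous coordinates of \<open>\<eta>\<close>.\<close>
  define y0 w0 :: complex
    where "y0 = (if \<eta> = None then 0 else 1)" and "w0 = (if \<eta> = None then 1 else the \<eta>)"
  obtain y w where yw: "lin_sol \<kappa> \<epsilon>' UNIV y w" "y a = y0" "w a = w0"
    using lin_sol_exists[OF bdd] by blast
  have 1: "(y a, w a) \<noteq> (0, 0)" and 2: "represents (x a) (y a) (w a)"
    using yw(2,3) x(2) by (auto simp: y0_def w0_def)
  have sol: "lin_sol \<kappa> \<epsilon>' {a..a + t} y w" by (rule lin_sol_subset[OF yw(1)]) auto
  have "represents (x (a + t)) (y (a + t)) (w (a + t))"
    using trajectory_represents[OF x(1) _ bdd sol 2] t by simp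
  then show "transfers \<kappa> \<epsilon>' a (a + t) \<eta> \<eta>'"
    using 1 2 sol unfolding transfers_def x(2,3) by blast
next
  assume "transfers \<kappa> \<epsilon>' a (a + t) \<eta> \<eta>'"
  then obtain y w where yw: "lin_sol \<kappa> \<epsilon>' {a..a + t} y w" "(y a, w a) \<noteq> (0, 0)"
    "represents \<eta> (y a) (w a)" "represents \<eta>' (y (a + t)) (w (a + t))"
    unfolding transfers_def by blast
  have nz: "(y s, w s) \<noteq> (0, 0)" if "s \<in> {a..a + t}" for s
    using lin_sol_nonzero[OF yw(1) bdd _ yw(2) that] t by simp
  have "\<eta> = quotient_state (y a) (w a)" "\<eta>' = quotient_state (y (a + t)) (w (a + t))"
    using yw(3,4) nz[of a] nz[of "a + t"] t by (simp_all add: represents_quotient_state)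
  then show "steers \<kappa> \<epsilon> a \<eta> \<eta>' t"
    unfolding steers_def trajectory_AE_cong[OF AE]
    using trajectory_quotient_state[OF yw(1) bdd nz] by blast
qed

section \<open>Null sets and essentially bounded functions\<close>

lemma AE_lebesgue_iff_negligible:
  fixes P :: "real \<Rightarrow> bool"
  shows "(AE s in lebesgue. P s) \<longleftrightarrow> negligible {s. \<not> P s}"
proof
  assume "AE s in lebesgue. P s"
  then obtain N where "negligible N" "{s. \<not> P s} \<subseteq> N"
    unfolding eventually_ae_filter negligible_iff_null_sets by auto
  then show "negligible {s. \<not> P s}" by (rule negligible_subset)
qed (auto simp: eventually_ae_filter negligible_iff_null_sets)

lemma AE_lebesgue_reflect:
  fixes P :: "real \<Rightarrow> bool"
  assumes "AE s in lebesgue. P s"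
  shows "AE s in lebesgue. P (- s)"
proof -
  have "{s. \<not> P (- s)} = uminus ` {s. \<not> P s}" by (auto simp: image_iff) (metis minus_minus)
  moreover have "negligible (uminus ` {s. \<not> P s})"
    using assms unfolding AE_lebesgue_iff_negligible
    by (intro negligible_differentiable_image_negligible) (auto intro!: derivative_intros)
  ultimately show ?thesis unfolding AE_lebesgue_iff_negligible by simp
qed

lemma AE_lebesgue_translate:
  fixes P :: "real \<Rightarrow> bool"
  assumes "AE s in lebesgue. P s"
  shows "AE s in lebesgue. P (s + h)"
proof -
  have "s \<in> (+) (- h) ` {s. \<not> P s}" if "\<not> P (s + h)" for s
    using that by (intro image_eqI[of _ _ "s + h"]) auto
  then have "{s. \<not> P (s + h)} \<subseteq> (+) (- h) ` {s. \<not> P s}" by blast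
  moreover have "negligible ((+) (- h) ` {s. \<not> P s})"
    using assms unfolding AE_lebesgue_iff_negligible by (rule negligible_translation)
  ultimately show ?thesis unfolding AE_lebesgue_iff_negligible by (rule negligible_subset[rotated])
qed

lemma AE_lebesgue_neq: "AE s in lebesgue. s \<noteq> (c::real)"
  unfolding AE_lebesgue_iff_negligible by simp

text \<open>
  Truncation at the essential bound, with the value 0 off \<open>S\<close>, gives a bounded representative on the
  whole line, to which global solvability applies.
\<close>

lemma Linf_on_bdd_coeff:
  assumes "Linf_on S \<epsilon>" "S \<in> sets lebesgue"
  obtains \<epsilon>' where "bdd_coeff \<epsilon>'" "AE s\<in>S in lebesgue. \<epsilon> s = \<epsilon>' s"
proof -
  obtain C where C: "AE s\<in>S in lebesgue. norm (\<epsilon> s) \<le> C" and meas: "\<epsilon> \<in> borel_measurable (lebesgue_on S)"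
    using assms(1) unfolding Linf_on_def by blast
  define \<epsilon>' where "\<epsilon>' s = max (- C) (min C (if s \<in> S then \<epsilon> s else 0))" for s
  have "(\<lambda>s. if s \<in> S then \<epsilon> s else 0) \<in> borel_measurable lebesgue"
    using meas assms(2) by (simp add: borel_measurable_if)
  then have "\<epsilon>' \<in> borel_measurable lebesgue" unfolding \<epsilon>'_def by measurable
  moreover have "\<bar>\<epsilon>' s\<bar> \<le> \<bar>C\<bar>" for s unfolding \<epsilon>'_def by auto
  ultimately have "bdd_coeff \<epsilon>'" unfolding bdd_coeff_def by blast
  moreover have "AE s\<in>S in lebesgue. \<epsilon> s = \<epsilon>' s" using C by eventually_elim (auto simp: \<epsilon>'_def)
  ultimately show thesis by (rule that)
qed

section \<open>The shortest interval of variation\<close>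

lemma AE_lessThan_Sup:
  fixes P :: "real \<Rightarrow> bool"
  assumes "\<And>n::nat. AE s\<in>{..<\<alpha> - inverse (Suc n)} in lebesgue. P s"
  shows "AE s\<in>{..<\<alpha>} in lebesgue. P s"
proof -
  have "AE s in lebesgue. \<forall>n::nat. s \<in> {..<\<alpha> - inverse (Suc n)} \<longrightarrow> P s"
    unfolding AE_all_countable using assms by blast
  then show ?thesis
  proof eventually_elim
    case (elim s)
    show ?case
    proof
      assume "s \<in> {..<\<alpha>}"
      then obtain n where "inverse (real (Suc n)) < \<alpha> - s" using reals_Archimedean[of "\<alpha> - s"] by auto
      then show "P s" using elim[rule_format, of n] by auto
    qed
  qed
qed

text \<open>
  The threshold is the supremum of all admissible \<open>a\<close>. It is itself admissible
  because \<open>{..<\<alpha>}\<close> is a countable union of smaller half-lines.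
\<close>

lemma AE_lessThan_threshold:
  fixes P :: "real \<Rightarrow> bool"
  assumes "AE s\<in>{..<a0} in lebesgue. P s" and bdd: "\<And>a. AE s\<in>{..<a} in lebesgue. P s \<Longrightarrow> a \<le> M"
  shows "\<exists>\<alpha>. \<forall>a. (AE s\<in>{..<a} in lebesgue. P s) \<longleftrightarrow> a \<le> \<alpha>"
proof -
  define A where "A = {a. AE s\<in>{..<a} in lebesgue. P s}"
  have down: "b \<in> A" if "a \<in> A" "b \<le> a" for a b
  proof -
    have "AE s\<in>{..<a} in lebesgue. P s" using that by (simp add: A_def)
    then have "AE s\<in>{..<b} in lebesgue. P s" by eventually_elim (use that in auto)
    then show ?thesis by (simp add: A_def)
  qed
  have A: "a0 \<in> A" "bdd_above A" using assms by (auto simp: A_def bdd_above_def)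
  have "Sup A \<in> A"
  proof -
    have "Sup A - inverse (Suc n) \<in> A" for n
    proof -
      have "Sup A - inverse (Suc n) < Sup A" by simp
      then obtain a where "a \<in> A" "Sup A - inverse (Suc n) < a"
        using less_cSupD[of A "Sup A - inverse (Suc n)"] A(1) by blast
      then show ?thesis using down by simp
    qed
    then show ?thesis unfolding A_def using AE_lessThan_Sup by blast
  qed
  then have "a \<in> A \<longleftrightarrow> a \<le> Sup A" for a using down A(2) by (auto intro: cSup_upper)
  moreover have "a \<in> A \<longleftrightarrow> (AE s\<in>{..<a} in lebesgue. P s)" for a
    by (simp only: A_def mem_Collect_eq)
  ultimately have "\<forall>a. (AE s\<in>{..<a} in lebesgue. P s) \<longleftrightarrow> a \<le> Sup A" by blast
  then show ?thesis by (rule exI)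
qed

lemma AE_greaterThan_threshold:
  fixes P :: "real \<Rightarrow> bool"
  assumes "AE s\<in>{b0<..} in lebesgue. P s" and bdd: "\<And>b. AE s\<in>{b<..} in lebesgue. P s \<Longrightarrow> M \<le> b"
  shows "\<exists>\<beta>. \<forall>b. (AE s\<in>{b<..} in lebesgue. P s) \<longleftrightarrow> \<beta> \<le> b"
proof -
  have reflect: "(AE s\<in>{..<a} in lebesgue. P (- s)) \<longleftrightarrow> (AE s\<in>{- a<..} in lebesgue. P s)" for a
  proof
    assume "AE s\<in>{..<a} in lebesgue. P (- s)"
    from AE_lebesgue_reflect[OF this] show "AE s\<in>{- a<..} in lebesgue. P s" by (simp add: minus_less_iff)
  next
    assume "AE s\<in>{- a<..} in lebesgue. P s"
    from AE_lebesgue_reflect[OF this] show "AE s\<in>{..<a} in lebesgue. P (- s)" by simp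
  qed
  have "\<exists>\<alpha>. \<forall>a. (AE s\<in>{..<a} in lebesgue. P (- s)) \<longleftrightarrow> a \<le> \<alpha>"
  proof (rule AE_lessThan_threshold[of "- b0" "\<lambda>s. P (- s)" "- M"])
    show "AE s\<in>{..<- b0} in lebesgue. P (- s)" using assms(1) unfolding reflect by simp
    show "a \<le> - M" if "AE s\<in>{..<a} in lebesgue. P (- s)" for a
      using bdd[of "- a"] that unfolding reflect by simp
  qed
  then obtain \<alpha> where \<alpha>: "\<And>a. (AE s\<in>{..<a} in lebesgue. P (- s)) \<longleftrightarrow> a \<le> \<alpha>" by auto
  have "(AE s\<in>{b<..} in lebesgue. P s) \<longleftrightarrow> - \<alpha> \<le> b" for b
    using \<alpha>[of "- b"] unfolding reflect by auto
  then show ?thesis by blast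
qed

lemma const_outside_iff:
  "const_outside ninf \<epsilon> a b \<longleftrightarrow> a \<le> b \<and>
     (AE s\<in>{..<a} in lebesgue. \<epsilon> s = ninf\<^sup>2) \<and> (AE s\<in>{b<..} in lebesgue. \<epsilon> s = ninf\<^sup>2)"
proof -
  have "(AE s\<in>- {a..b} in lebesgue. \<epsilon> s = ninf\<^sup>2) \<longleftrightarrow>
     (AE s in lebesgue. (s \<in> {..<a} \<longrightarrow> \<epsilon> s = ninf\<^sup>2) \<and> (s \<in> {b<..} \<longrightarrow> \<epsilon> s = ninf\<^sup>2))"
    by (rule arg_cong[where f = "\<lambda>P. AE s in lebesgue. P s"]) auto
  then show ?thesis unfolding const_outside_def by simp
qed

text \<open>
  The conditions to the left of \<open>a\<close> and to the right of \<open>b\<close> are independent of each other, and each has a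
  sharp threshold \<open>\<alpha>\<close>, \<open>\<beta>\<close>. If \<open>\<alpha> \<ge> \<beta>\<close>, the two half-lines would cover the line up to a null set
  and \<open>\<epsilon>\<close> would be constant. Hence the intervals outside of which \<open>\<epsilon>\<close> is constant are those that
  contain \<open>[\<alpha>, \<beta>]\<close>, and the description by minimal length has a unique solution.
\<close>

lemma shortest_interval_least:
  assumes nonconst: "\<not> (AE s in lebesgue. \<epsilon> s = ninf\<^sup>2)" and ex: "const_outside ninf \<epsilon> a0 b0"
  obtains "s_minus ninf \<epsilon> < s_plus ninf \<epsilon>"
    "\<And>a b. const_outside ninf \<epsilon> a b \<longleftrightarrow> a \<le> s_minus ninf \<epsilon> \<and> s_plus ninf \<epsilon> \<le> b"
proof -
  let ?P = "\<lambda>s. \<epsilon> s = ninf\<^sup>2"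
  have less: "a < b" if "AE s\<in>{..<a} in lebesgue. ?P s" "AE s\<in>{b<..} in lebesgue. ?P s" for a b
  proof (rule ccontr)
    assume "\<not> a < b"
    with that AE_lebesgue_neq[of a] have "AE s in lebesgue. ?P s"
      by (elim AE_mp) (auto intro!: AE_I2)
    then show False using nonconst by simp
  qed
  have ex': "AE s\<in>{..<a0} in lebesgue. ?P s" "AE s\<in>{b0<..} in lebesgue. ?P s"
    using ex unfolding const_outside_iff by auto
  have "\<exists>\<alpha>. \<forall>a. (AE s\<in>{..<a} in lebesgue. ?P s) \<longleftrightarrow> a \<le> \<alpha>"
    using less[OF _ ex'(2)] by (intro AE_lessThan_threshold[OF ex'(1), of b0] less_imp_le)
  then obtain \<alpha> where \<alpha>: "\<And>a. (AE s\<in>{..<a} in lebesgue. ?P s) \<longleftrightarrow> a \<le> \<alpha>" by auto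
  have "\<exists>\<beta>. \<forall>b. (AE s\<in>{b<..} in lebesgue. ?P s) \<longleftrightarrow> \<beta> \<le> b"
    using less[OF ex'(1)] by (intro AE_greaterThan_threshold[OF ex'(2), of a0] less_imp_le)
  then obtain \<beta> where \<beta>: "\<And>b. (AE s\<in>{b<..} in lebesgue. ?P s) \<longleftrightarrow> \<beta> \<le> b" by auto
  have \<alpha>\<beta>: "\<alpha> < \<beta>" using less[of \<alpha> \<beta>] \<alpha> \<beta> by simp
  have iff: "const_outside ninf \<epsilon> a b \<longleftrightarrow> a \<le> \<alpha> \<and> \<beta> \<le> b" for a b
    unfolding const_outside_iff \<alpha> \<beta> using \<alpha>\<beta> by auto
  have "(THE (a, b). const_outside ninf \<epsilon> a b \<and>
             (\<forall>a' b'. const_outside ninf \<epsilon> a' b' \<longrightarrow> b - a \<le> b' - a')) = (\<alpha>, \<beta>)"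
  proof (rule the_equality)
    show "case (\<alpha>, \<beta>) of (a, b) \<Rightarrow> const_outside ninf \<epsilon> a b \<and>
             (\<forall>a' b'. const_outside ninf \<epsilon> a' b' \<longrightarrow> b - a \<le> b' - a')"
      by (auto simp: iff)
    fix p assume "case p of (a, b) \<Rightarrow> const_outside ninf \<epsilon> a b \<and>
             (\<forall>a' b'. const_outside ninf \<epsilon> a' b' \<longrightarrow> b - a \<le> b' - a')"
    then show "p = (\<alpha>, \<beta>)" by (cases p) (fastforce simp: iff)
  qed
  then have "shortest_interval ninf \<epsilon> = (\<alpha>, \<beta>)"
    using nonconst by (simp add: shortest_interval_def)
  then have "s_minus ninf \<epsilon> = \<alpha>" "s_plus ninf \<epsilon> = \<beta>" by (auto simp: s_minus_def s_plus_def)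
  then show thesis using that \<alpha>\<beta> iff by blast
qed

section \<open>Modes and the linear system\<close>

text \<open>
  A mode must be differentiable everywhere. This applies to the first component of a linear solution,
  being a primitive of a multiple of the continuous function \<open>w\<close>.
\<close>

lemma is_primitive_has_vector_derivative:
  assumes F: "is_primitive UNIV F f" and f: "continuous_on UNIV f"
  shows "(F has_vector_derivative f s) (at s)"
proof -
  have "((\<lambda>u. integral {s - 1..u} f) has_vector_derivative f s) (at s within {s - 1..s + 1})"
    by (rule integral_has_vector_derivative) (auto intro: continuous_on_subset[OF f])
  then have "((\<lambda>u. F (s - 1) + integral {s - 1..u} f) has_vector_derivative 0 + f s) (at s within {s - 1..s + 1})"
    by (intro has_vector_derivative_add has_vector_derivative_const)
  then have "((\<lambda>u. F (s - 1) + integral {s - 1..u} f) has_vector_derivative f s) (at s within {s - 1..s + 1})"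
    by simp
  then have "(F has_vector_derivative f s) (at s within {s - 1..s + 1})"
  proof (rule has_vector_derivative_transform[rotated -1])
    fix u assume "u \<in> {s - 1..s + 1}"
    then have "(f has_integral F u - F (s - 1)) {s - 1..u}" by (intro is_primitiveD[OF F]) auto
    then show "F u = F (s - 1) + integral {s - 1..u} f" by (simp add: integral_unique)
  qed auto
  then show ?thesis by (simp add: at_within_Icc_at)
qed

lemma lin_sol_has_vector_derivative:
  assumes "lin_sol \<kappa> \<epsilon> UNIV y w"
  shows "(y has_vector_derivative \<i> * \<kappa> * w s) (at s)"
proof (rule is_primitive_has_vector_derivative)
  have "continuous_on UNIV w" using assms unfolding lin_sol_def
    by (auto intro: is_primitive_UNIV_continuous_on)
  then show "continuous_on UNIV (\<lambda>s. \<i> * \<kappa> * w s)" by (intro continuous_intros)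
qed (use assms in \<open>simp add: lin_sol_def\<close>)

lemma is_mode_iff_lin_sol:
  assumes \<kappa>: "\<kappa> \<noteq> 0" and Linf: "Linf_on UNIV \<epsilon>"
  shows "is_mode ninf \<epsilon> \<kappa> y \<longleftrightarrow> (\<exists>s. y s \<noteq> 0) \<and>
    (\<exists>w. lin_sol \<kappa> \<epsilon> UNIV y w \<and>
      (\<exists>a b. const_outside ninf \<epsilon> a b \<and> w a = - of_real ninf * y a \<and> w b = of_real ninf * y b))"
    (is "_ \<longleftrightarrow> _ \<and> ?R")
proof
  assume "is_mode ninf \<epsilon> \<kappa> y"
  then obtain y1 y2 a b where nz: "\<exists>s. y s \<noteq> 0" and W2: "W2inf_loc y y1 y2"
    and eq: "AE s in lebesgue. y2 s = - \<kappa>\<^sup>2 * of_real (\<epsilon> s) * y s"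
    and ab: "const_outside ninf \<epsilon> a b"
    and bc: "y1 a / \<kappa> = - \<i> * of_real ninf * y a" "y1 b / \<kappa> = \<i> * of_real ninf * y b"
    unfolding is_mode_def by blast
  let ?w = "\<lambda>s. inverse (\<i> * \<kappa>) * y1 s"
  have "is_primitive UNIV y y1"
    unfolding is_primitive_def
  proof (intro allI impI)
    fix c d :: real assume "c \<le> d \<and> {c..d} \<subseteq> UNIV"
    then show "(y1 has_integral y d - y c) {c..d}"
      using W2 unfolding W2inf_loc_def
      by (intro fundamental_theorem_of_calculus) (auto intro: has_vector_derivative_at_within)
  qed
  moreover have "y1 = (\<lambda>s. \<i> * \<kappa> * ?w s)" using \<kappa> by (auto simp: fun_eq_iff field_simps)
  ultimately have 1: "is_primitive UNIV y (\<lambda>s. \<i> * \<kappa> * ?w s)" by simp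
  have 2: "is_primitive UNIV ?w (\<lambda>s. inverse (\<i> * \<kappa>) * y2 s)"
    using W2 unfolding W2inf_loc_def by (intro is_primitive_cmult) blast
  have "AE s\<in>UNIV in lebesgue. inverse (\<i> * \<kappa>) * y2 s = \<i> * \<kappa> * of_real (\<epsilon> s) * y s"
    using eq by eventually_elim (use \<kappa> in \<open>simp add: field_simps power2_eq_square\<close>)
  from 1 2[unfolded is_primitive_AE_cong[OF this]] have "lin_sol \<kappa> \<epsilon> UNIV y ?w" unfolding lin_sol_def by simp
  moreover have "?w a = - of_real ninf * y a" "?w b = of_real ninf * y b"
    using bc \<kappa> by (auto simp: field_simps)
  ultimately show "(\<exists>s. y s \<noteq> 0) \<and> ?R" using nz ab by blast
next
  assume "(\<exists>s. y s \<noteq> 0) \<and> ?R"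
  then obtain w a b where nz: "\<exists>s. y s \<noteq> 0" and sol: "lin_sol \<kappa> \<epsilon> UNIV y w"
    and ab: "const_outside ninf \<epsilon> a b" and bc: "w a = - of_real ninf * y a" "w b = of_real ninf * y b"
    by blast
  let ?y1 = "\<lambda>s. \<i> * \<kappa> * w s" and ?y2 = "\<lambda>s. - \<kappa>\<^sup>2 * of_real (\<epsilon> s) * y s"
  have w: "is_primitive UNIV w (\<lambda>s. \<i> * \<kappa> * of_real (\<epsilon> s) * y s)"
    and y: "is_primitive UNIV y ?y1" using sol by (auto simp: lin_sol_def)
  have y1: "is_primitive UNIV ?y1 ?y2"
    using is_primitive_cmult[OF w, of "\<i> * \<kappa>"] by (simp add: power2_eq_square algebra_simps)
  have "Linf_on {a..b} ?y2" for a b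
    unfolding Linf_on_def
  proof
    have "?y2 integrable_on {a..b}"
      using is_primitiveD[OF y1, of a b] by (cases "a \<le> b") (auto simp: has_integral_integrable)
    then show "?y2 \<in> borel_measurable (lebesgue_on {a..b})" by (rule integrable_imp_measurable)
    obtain C where C: "AE s in lebesgue. norm (\<epsilon> s) \<le> C" using Linf unfolding Linf_on_def by auto
    obtain M where M: "\<And>s. s \<in> {a..b} \<Longrightarrow> norm (y s) \<le> M"
      using bounded_on_Icc[OF is_primitive_UNIV_continuous_on[OF y]] by blast
    have "AE s\<in>{a..b} in lebesgue. norm (?y2 s) \<le> norm (\<kappa>\<^sup>2) * C * M"
      using C
    proof eventually_elim
      case (elim s)
      then show ?case using M[of s] by (auto simp: norm_mult intro!: mult_mono mult_nonneg_nonneg)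
    qed
    then show "\<exists>C. AE s\<in>{a..b} in lebesgue. norm (?y2 s) \<le> C" by blast
  qed
  then have "W2inf_loc y ?y1 ?y2"
    unfolding W2inf_loc_def using lin_sol_has_vector_derivative[OF sol] y1 by blast
  moreover have "?y1 a / \<kappa> = - \<i> * of_real ninf * y a" "?y1 b / \<kappa> = \<i> * of_real ninf * y b"
    using bc \<kappa> by auto
  moreover have "AE s in lebesgue. ?y2 s = - \<kappa>\<^sup>2 * of_real (\<epsilon> s) * y s" by simp
  ultimately show "is_mode ninf \<epsilon> \<kappa> y" unfolding is_mode_def using nz ab by blast
qed

text \<open>
  Where \<open>\<epsilon> = n\<^sup>2\<close>, the constants \<open>\<plusminus>n\<close> are equilibria of the Riccati equation, so that the boundary
  conditions \<open>w = \<plusminus>n y\<close> are carried along. This makes the choice of the interval in the definition of a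
  mode immaterial, as the next two lemmas state for its left and its right end.
\<close>

lemma lin_sol_equilibrium:
  assumes sol: "lin_sol \<kappa> \<epsilon> {a..b} y w" and const: "AE s\<in>{a..b} in lebesgue. \<epsilon> s = n\<^sup>2"
    and z: "z\<^sup>2 = of_real (n\<^sup>2)" and pq: "p \<in> {a..b}" "q \<in> {a..b}" "w p = z * y p"
  shows "w q = z * y q"
proof -
  have "lin_sol \<kappa> (\<lambda>_. n\<^sup>2) {a..b} y w" using sol lin_sol_AE_cong[OF const] by simp
  moreover have "is_primitive {a..b} (\<lambda>_. z) (\<lambda>s. \<i> * \<kappa> * (- z\<^sup>2 + of_real (n\<^sup>2)))"
    by (simp add: z is_primitive_def)
  ultimately show ?thesis
    using Riccati_represents[of \<kappa> "\<lambda>_. n\<^sup>2" a b y w "\<lambda>_. z" p q] pq by (auto simp: bdd_coeff_def)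
qed

lemma lin_sol_boundary_left:
  assumes "lin_sol \<kappa> \<epsilon> UNIV y w" "const_outside n \<epsilon> a b" "const_outside n \<epsilon> a' b'" "z\<^sup>2 = of_real (n\<^sup>2)"
    and "w a = z * y a"
  shows "w a' = z * y a'"
proof (rule lin_sol_equilibrium)
  show "lin_sol \<kappa> \<epsilon> {min a a'..max a a'} y w" using assms(1) by (rule lin_sol_subset) simp
  have "AE s\<in>{..<max a a'} in lebesgue. \<epsilon> s = n\<^sup>2"
    using assms(2,3) unfolding const_outside_iff by (auto simp: max_def)
  with AE_lebesgue_neq[of "max a a'"]
  show "AE s\<in>{min a a'..max a a'} in lebesgue. \<epsilon> s = n\<^sup>2" by eventually_elim auto
qed (use assms in auto)

lemma lin_sol_boundary_right:
  assumes "lin_sol \<kappa> \<epsilon> UNIV y w" "const_outside n \<epsilon> a b" "const_outside n \<epsilon> a' b'" "z\<^sup>2 = of_real (n\<^sup>2)"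
    and "w b = z * y b"
  shows "w b' = z * y b'"
proof (rule lin_sol_equilibrium)
  show "lin_sol \<kappa> \<epsilon> {min b b'..max b b'} y w" using assms(1) by (rule lin_sol_subset) simp
  have "AE s\<in>{min b b'<..} in lebesgue. \<epsilon> s = n\<^sup>2"
    using assms(2,3) unfolding const_outside_iff by (auto simp: min_def)
  with AE_lebesgue_neq[of "min b b'"]
  show "AE s\<in>{min b b'..max b b'} in lebesgue. \<epsilon> s = n\<^sup>2" by eventually_elim auto
qed (use assms in auto)

lemma lin_sol_UNIV_nonzero:
  assumes "lin_sol \<kappa> \<epsilon> UNIV y w" "Linf_on UNIV \<epsilon>" "(y p, w p) \<noteq> (0, 0)"
  shows "(y q, w q) \<noteq> (0, 0)"
proof -
  obtain \<epsilon>' where \<epsilon>': "bdd_coeff \<epsilon>'" "AE s\<in>UNIV in lebesgue. \<epsilon> s = \<epsilon>' s"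
    using Linf_on_bdd_coeff[OF assms(2)] by auto
  have "lin_sol \<kappa> \<epsilon>' {min p q..max p q} y w"
    using assms(1) lin_sol_AE_cong[OF \<epsilon>'(2)] by (auto intro: lin_sol_subset)
  from lin_sol_nonzero[OF this \<epsilon>'(1) _ assms(3)] show ?thesis by auto
qed

text \<open>
  If \<open>y\<close> vanished identically, so would its derivative \<open>\<i> \<kappa> w\<close>.
\<close>

lemma lin_sol_y_nonzero:
  assumes sol: "lin_sol \<kappa> \<epsilon> UNIV y w" and "\<kappa> \<noteq> 0" "(y p, w p) \<noteq> (0, 0)"
  shows "\<exists>s. y s \<noteq> 0"
proof (rule ccontr)
  assume "\<not> (\<exists>s. y s \<noteq> 0)"
  then have y: "y = (\<lambda>_. 0)" by auto
  have "((\<lambda>_. 0) has_vector_derivative \<i> * \<kappa> * w p) (at p)"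
    using lin_sol_has_vector_derivative[OF sol] unfolding y .
  from vector_derivative_unique_at[OF this has_vector_derivative_const] have "w p = 0" using assms(2) by simp
  then show False using assms(3) y by simp
qed

lemma transfers_global_Linf:
  assumes "transfers \<kappa> \<epsilon> a b \<eta> \<eta>'" "Linf_on UNIV \<epsilon>" "a \<le> b"
  obtains y w where "lin_sol \<kappa> \<epsilon> UNIV y w" "(y a, w a) \<noteq> (0, 0)"
    "represents \<eta> (y a) (w a)" "represents \<eta>' (y b) (w b)"
proof -
  obtain \<epsilon>' where \<epsilon>': "bdd_coeff \<epsilon>'" "AE s\<in>UNIV in lebesgue. \<epsilon> s = \<epsilon>' s"
    using Linf_on_bdd_coeff[OF assms(2)] by auto
  have "AE s\<in>{a..b} in lebesgue. \<epsilon> s = \<epsilon>' s" using \<epsilon>'(2) by eventually_elim auto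
  then have "transfers \<kappa> \<epsilon>' a b \<eta> \<eta>'" using assms(1) transfers_AE_cong by blast
  from transfers_global[OF this \<epsilon>'(1) assms(3)] that show thesis
    unfolding lin_sol_AE_cong[OF \<epsilon>'(2), symmetric] by blast
qed

text \<open>
  In homogeneous coordinates, the boundary conditions of a mode say that \<open>[w : y]\<close> is \<open>- n\<^sub>\<infinity>\<close> at the left
  end and \<open>n\<^sub>\<infinity>\<close> at the right end.
\<close>

lemma resonance_iff_transfers:
  assumes \<kappa>: "\<kappa> \<noteq> 0" and Linf: "Linf_on UNIV \<epsilon>" and ab: "const_outside ninf \<epsilon> a b"
  shows "\<kappa> \<in> resonances ninf \<epsilon> \<longleftrightarrow> transfers \<kappa> \<epsilon> a b (Some (- of_real ninf)) (Some (of_real ninf))"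
proof
  assume "\<kappa> \<in> resonances ninf \<epsilon>"
  then obtain y where "is_mode ninf \<epsilon> \<kappa> y" by (auto simp: resonances_def)
  then obtain w a' b' where *: "\<exists>s. y s \<noteq> 0" "lin_sol \<kappa> \<epsilon> UNIV y w" "const_outside ninf \<epsilon> a' b'"
    "w a' = - of_real ninf * y a'" "w b' = of_real ninf * y b'"
    unfolding is_mode_iff_lin_sol[OF \<kappa> Linf] by blast
  have "w a = - of_real ninf * y a" by (rule lin_sol_boundary_left[OF *(2,3) ab _ *(4)]) simp
  moreover have "w b = of_real ninf * y b" by (rule lin_sol_boundary_right[OF *(2,3) ab _ *(5)]) simp
  moreover have "(y a, w a) \<noteq> (0, 0)" using lin_sol_UNIV_nonzero[OF *(2) Linf] *(1) by blast
  moreover have "lin_sol \<kappa> \<epsilon> {a..b} y w" using *(2) by (rule lin_sol_subset) simp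
  ultimately show "transfers \<kappa> \<epsilon> a b (Some (- of_real ninf)) (Some (of_real ninf))"
    unfolding transfers_def represents_Some by blast
next
  assume T: "transfers \<kappa> \<epsilon> a b (Some (- of_real ninf)) (Some (of_real ninf))"
  have "a \<le> b" using ab by (simp add: const_outside_def)
  then obtain y w where *: "lin_sol \<kappa> \<epsilon> UNIV y w" "(y a, w a) \<noteq> (0, 0)"
    "w a = - of_real ninf * y a" "w b = of_real ninf * y b"
    using transfers_global_Linf[OF T Linf, unfolded represents_Some] by blast
  then have "is_mode ninf \<epsilon> \<kappa> y"
    unfolding is_mode_iff_lin_sol[OF \<kappa> Linf]
    using lin_sol_y_nonzero[OF *(1) \<kappa> *(2)] ab by blast
  then show "\<kappa> \<in> resonances ninf \<epsilon>" using \<kappa> by (auto simp: resonances_def)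
qed

lemma lin_sol_reflect:
  assumes "lin_sol \<kappa> \<epsilon> UNIV y w"
  shows "lin_sol \<kappa> (\<lambda>s. \<epsilon> (- s)) UNIV (\<lambda>s. \<sigma> * y (- s)) (\<lambda>s. - \<sigma> * w (- s))"
  using assms is_primitive_cmult[OF is_primitive_reflect[of y "\<lambda>s. \<i> * \<kappa> * w s"], of \<sigma>]
    is_primitive_cmult[OF is_primitive_reflect[of w "\<lambda>s. \<i> * \<kappa> * of_real (\<epsilon> s) * y s"], of "- \<sigma>"]
  unfolding lin_sol_def by (simp add: algebra_simps)

text \<open>
  Odd (\<open>\<sigma> = - 1\<close>) and even (\<open>\<sigma> = 1\<close>) modes at once. For symmetric \<open>\<epsilon>\<close>, the map
  \<open>(y, w) \<mapsto> (\<sigma> y (- s), - \<sigma> w (- s))\<close> preserves solutions, so by uniqueness a solution has parity \<open>\<sigma>\<close> if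
  and only if its value at \<open>0\<close> is fixed by \<open>(y0, w0) \<mapsto> (\<sigma> y0, - \<sigma> w0)\<close>. This singles out one point \<open>\<eta>\<close> of
  the sphere: \<open>\<infinity>\<close> for odd, \<open>0\<close> for even modes. The boundary condition at \<open>- b\<close> is the reflection of the one
  at \<open>b\<close>.
\<close>

lemma symmetric_mode_iff_transfers:
  assumes \<kappa>: "\<kappa> \<noteq> 0" and Linf: "Linf_on UNIV \<epsilon>" and sym: "AE s in lebesgue. \<epsilon> s = \<epsilon> (- s)"
    and b: "const_outside ninf \<epsilon> (- b) b"
    and \<sigma>: "\<sigma>\<^sup>2 = 1"
    and \<eta>: "\<And>y0 w0. represents \<eta> y0 w0 \<longleftrightarrow> y0 = \<sigma> * y0 \<and> w0 = - \<sigma> * w0"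
  shows "(\<exists>y. is_mode ninf \<epsilon> \<kappa> y \<and> (\<forall>s. y (- s) = \<sigma> * y s)) \<longleftrightarrow>
    transfers \<kappa> \<epsilon> 0 b \<eta> (Some (of_real ninf))"
proof
  assume "\<exists>y. is_mode ninf \<epsilon> \<kappa> y \<and> (\<forall>s. y (- s) = \<sigma> * y s)"
  then obtain y w a' b' where *: "\<exists>s. y s \<noteq> 0" "lin_sol \<kappa> \<epsilon> UNIV y w" "const_outside ninf \<epsilon> a' b'"
    "w a' = - of_real ninf * y a'" "w b' = of_real ninf * y b'" and par: "\<And>s. y (- s) = \<sigma> * y s"
    unfolding is_mode_iff_lin_sol[OF \<kappa> Linf] by blast
  have d: "(y has_vector_derivative \<i> * \<kappa> * w 0) (at 0)"
    by (rule lin_sol_has_vector_derivative[OF *(2)])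
  have "(uminus has_vector_derivative (- 1 :: real)) (at (0 :: real))"
    by (auto intro!: derivative_eq_intros simp: has_real_derivative_iff_has_vector_derivative[symmetric])
  from vector_diff_chain_at[OF this, of y "\<i> * \<kappa> * w 0"] d
  have "((\<lambda>s. y (- s)) has_vector_derivative - (\<i> * \<kappa> * w 0)) (at 0)" by (simp add: o_def)
  moreover have "((\<lambda>s. y (- s)) has_vector_derivative \<sigma> * (\<i> * \<kappa> * w 0)) (at 0)"
    unfolding par using d by (intro has_vector_derivative_mult_right)
  ultimately have "- (\<i> * \<kappa> * w 0) = \<sigma> * (\<i> * \<kappa> * w 0)" by (rule vector_derivative_unique_at)
  then have "\<i> * \<kappa> * (- w 0) = \<i> * \<kappa> * (\<sigma> * w 0)" by (simp only: mult.left_commute mult_minus_right)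
  then have "- w 0 = \<sigma> * w 0"
    by (rule mult_left_cancel[THEN iffD1, rotated]) (use \<kappa> in simp)
  then have "- (- w 0) = - (\<sigma> * w 0)" by (rule arg_cong)
  then have "w 0 = - \<sigma> * w 0" by simp
  then have "represents \<eta> (y 0) (w 0)" using par[of 0] \<eta> by simp
  moreover have "w b = of_real ninf * y b" by (rule lin_sol_boundary_right[OF *(2,3) b _ *(5)]) simp
  moreover have "(y 0, w 0) \<noteq> (0, 0)" using lin_sol_UNIV_nonzero[OF *(2) Linf] *(1) by blast
  moreover have "lin_sol \<kappa> \<epsilon> {0..b} y w" using *(2) by (rule lin_sol_subset) simp
  ultimately show "transfers \<kappa> \<epsilon> 0 b \<eta> (Some (of_real ninf))"
    unfolding transfers_def represents_Some by blast
next
  assume T: "transfers \<kappa> \<epsilon> 0 b \<eta> (Some (of_real ninf))"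
  have b0: "0 \<le> b" using b by (simp add: const_outside_def)
  obtain \<epsilon>' where \<epsilon>': "bdd_coeff \<epsilon>'" "AE s\<in>UNIV in lebesgue. \<epsilon> s = \<epsilon>' s"
    using Linf_on_bdd_coeff[OF Linf] by auto
  obtain y w where yw: "lin_sol \<kappa> \<epsilon> UNIV y w" "(y 0, w 0) \<noteq> (0, 0)"
    "represents \<eta> (y 0) (w 0)" "w b = of_real ninf * y b"
    using transfers_global_Linf[OF T Linf b0, unfolded represents_Some] by blast
  have sym': "AE s\<in>UNIV in lebesgue. \<epsilon> (- s) = \<epsilon>' s" using sym \<epsilon>'(2) by eventually_elim auto
  have sol1: "lin_sol \<kappa> \<epsilon>' UNIV y w" using yw(1) lin_sol_AE_cong[OF \<epsilon>'(2)] by simp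
  have sol2: "lin_sol \<kappa> \<epsilon>' UNIV (\<lambda>s. \<sigma> * y (- s)) (\<lambda>s. - \<sigma> * w (- s))"
    using lin_sol_reflect[OF yw(1)] lin_sol_AE_cong[OF sym'] by simp
  have y0: "\<sigma> * y 0 = y 0" "- \<sigma> * w 0 = w 0" using yw(3) \<eta>[of "y 0" "w 0"] by auto
  have eq: "\<sigma> * y (- s) = y s \<and> - \<sigma> * w (- s) = w s" for s
  proof (rule lin_sol_unique[OF _ _ \<epsilon>'(1), where p = 0 and q = s])
    show "lin_sol \<kappa> \<epsilon>' {- \<bar>s\<bar>..\<bar>s\<bar>} (\<lambda>s. \<sigma> * y (- s)) (\<lambda>s. - \<sigma> * w (- s))"
      using sol2 by (rule lin_sol_subset) simp
    show "lin_sol \<kappa> \<epsilon>' {- \<bar>s\<bar>..\<bar>s\<bar>} y w"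
      using sol1 by (rule lin_sol_subset) simp
    show "\<sigma> * y (- 0) = y 0" "- \<sigma> * w (- 0) = w 0" using y0 by simp_all
  qed auto
  have par: "y (- s) = \<sigma> * y s" for s using eq[of "- s"] by simp
  have "w (- b) = - \<sigma> * w b" using eq[of "- b"] by simp
  then have "w (- b) = - of_real ninf * y (- b)" using yw(4) par[of b] by simp
  then have "is_mode ninf \<epsilon> \<kappa> y"
    unfolding is_mode_iff_lin_sol[OF \<kappa> Linf] using lin_sol_y_nonzero[OF yw(1) \<kappa> yw(2)] yw(1,4) b by blast
  then show "\<exists>y. is_mode ninf \<epsilon> \<kappa> y \<and> (\<forall>s. y (- s) = \<sigma> * y s)" using par by blast
qed

lemma resonance_odd_iff_transfers:
  assumes "\<kappa> \<noteq> 0" "Linf_on UNIV \<epsilon>" "AE s in lebesgue. \<epsilon> s = \<epsilon> (- s)" "const_outside ninf \<epsilon> (- b) b"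
  shows "\<kappa> \<in> resonances_odd ninf \<epsilon> \<longleftrightarrow> transfers \<kappa> \<epsilon> 0 b None (Some (of_real ninf))"
  using symmetric_mode_iff_transfers[OF assms, of "- 1" None] assms(1)
  by (simp add: resonances_odd_def equal_neg_zero)

lemma resonance_even_iff_transfers:
  assumes "\<kappa> \<noteq> 0" "Linf_on UNIV \<epsilon>" "AE s in lebesgue. \<epsilon> s = \<epsilon> (- s)" "const_outside ninf \<epsilon> (- b) b"
  shows "\<kappa> \<in> resonances_even ninf \<epsilon> \<longleftrightarrow> transfers \<kappa> \<epsilon> 0 b (Some 0) (Some (of_real ninf))"
  using symmetric_mode_iff_transfers[OF assms, of 1 "Some 0"] assms(1)
  by (simp add: resonances_even_def equal_neg_zero)

section \<open>Exchanging controls and coefficients\<close>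

text \<open>
  A Borel representative that obeys the bounds everywhere. Such functions are stable under translation,
  reflection and piecewise definition.
\<close>

lemma Linf_on_borel_clip:
  fixes \<epsilon> :: "real \<Rightarrow> real"
  assumes "Linf_on S \<epsilon>" "S \<in> sets lebesgue" and "lo \<le> hi"
    and "AE s\<in>S in lebesgue. lo \<le> \<epsilon> s \<and> \<epsilon> s \<le> hi"
  obtains f where "f \<in> borel_measurable borel" "\<And>s. lo \<le> f s \<and> f s \<le> hi"
    "AE s\<in>S in lebesgue. \<epsilon> s = f s"
proof -
  obtain g where g: "bdd_coeff g" "AE s\<in>S in lebesgue. \<epsilon> s = g s"
    using Linf_on_bdd_coeff[OF assms(1,2)] by blast
  then have "g \<in> borel_measurable (completion lborel)" by (simp add: bdd_coeff_def)
  then obtain f where f: "f \<in> borel_measurable lborel" "AE s in lborel. g s = f s"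
    using completion_ex_borel_measurable_real by blast
  have "AE s in lebesgue. g s = f s" using f(2) by (rule AE_completion)
  with g(2) assms(4) have "AE s\<in>S in lebesgue. \<epsilon> s = max lo (min hi (f s))"
    by eventually_elim auto
  moreover have "(\<lambda>s. max lo (min hi (f s))) \<in> borel_measurable borel" using f(1) by measurable
  ultimately show thesis using that[of "\<lambda>s. max lo (min hi (f s))"] assms(3) by auto
qed

lemma borel_bounded_imp_bdd_coeff:
  assumes "f \<in> borel_measurable borel" "\<And>s. lo \<le> f s \<and> f s \<le> hi"
  shows "bdd_coeff f"
  unfolding bdd_coeff_def
proof
  show "f \<in> borel_measurable lebesgue" using assms(1) by (simp add: measurable_completion)
  have "\<bar>f s\<bar> \<le> max \<bar>lo\<bar> \<bar>hi\<bar>" for s using assms(2)[of s] by (auto simp: max_def)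
  then show "\<exists>B. \<forall>s. \<bar>f s\<bar> \<le> B" by blast
qed

lemma borel_bounded_imp_Linf_on:
  fixes f :: "real \<Rightarrow> real"
  assumes "f \<in> borel_measurable borel" "\<And>s. \<bar>f s\<bar> \<le> B"
  shows "Linf_on S f"
  unfolding Linf_on_def
proof
  have "f \<in> borel_measurable lebesgue" using assms(1) by (simp add: measurable_completion)
  then show "f \<in> borel_measurable (lebesgue_on S)" by (rule measurable_restrict_space1)
  show "\<exists>C. AE s\<in>S in lebesgue. norm (f s) \<le> C" using assms(2) by (intro exI[of _ B]) auto
qed

lemma restr_eqI: "AE s\<in>S in lebesgue. f s = g s \<Longrightarrow> restr S f = restr S g"
proof -
  assume AE: "AE s\<in>S in lebesgue. f s = g s"
  have "(AE s\<in>S in lebesgue. h s = f s) \<longleftrightarrow> (AE s\<in>S in lebesgue. h s = g s)" for h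
  proof
    assume "AE s\<in>S in lebesgue. h s = f s"
    with AE show "AE s\<in>S in lebesgue. h s = g s" by eventually_elim auto
  next
    assume "AE s\<in>S in lebesgue. h s = g s"
    with AE show "AE s\<in>S in lebesgue. h s = f s" by eventually_elim auto
  qed
  then show ?thesis unfolding restr_def by simp
qed

lemma AE_open_imp_closed_interval:
  assumes "AE s\<in>{a<..<b} in lebesgue. P s"
  shows "AE s\<in>{a..b::real} in lebesgue. P s"
  using assms AE_lebesgue_neq[of a] AE_lebesgue_neq[of b] by eventually_elim auto

text \<open>
  The optimisation part, common to the three problems. \<open>A\<close> is the set of admissible coefficients, \<open>l \<epsilon>\<close> the
  time at which the corresponding control starts (\<open>s\<^sub>-\<close>, or \<open>0\<close> for symmetric coefficients), \<open>C\<close> the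
  possible starting times, and \<open>m\<close> the ratio of length and duration.
  Restriction turns an admissible coefficient of length \<open>m * t\<close> into a control of duration \<open>t\<close>, and
  extension (the last hypothesis) turns a control of duration \<open>t\<close> into an admissible coefficient whose interval
  lies inside \<open>[c, c + t]\<close>, so its length is at most \<open>m * t\<close>. Hence the infima correspond. If \<open>t\<close> is the
  minimum time, then the length cannot be smaller than \<open>m * t\<close>, so the interval is all of \<open>[c, c + t]\<close> and
  no part of the control is lost in the extension.
\<close>

lemma min_time_problem_equivalence:
  fixes A :: "(real \<Rightarrow> real) set" and l :: "(real \<Rightarrow> real) \<Rightarrow> real" and C :: "real set" and m :: real
  assumes n: "0 < n1" "n1 < n2" and m: "0 < m" and C: "C \<noteq> {}"
    and Linf: "\<And>\<epsilon>. \<epsilon> \<in> A \<Longrightarrow> Linf_on UNIV \<epsilon>"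
    and l: "\<And>\<epsilon>. \<epsilon> \<in> A \<Longrightarrow> l \<epsilon> \<in> C \<and> l \<epsilon> \<le> s_plus ninf \<epsilon>"
    and len: "\<And>\<epsilon>. \<epsilon> \<in> A \<Longrightarrow> len ninf \<epsilon> = m * (s_plus ninf \<epsilon> - l \<epsilon>)"
    and bounds: "\<And>\<epsilon>. \<epsilon> \<in> A \<Longrightarrow>
      AE s\<in>{l \<epsilon><..<s_plus ninf \<epsilon>} in lebesgue. n1\<^sup>2 \<le> \<epsilon> s \<and> \<epsilon> s \<le> n2\<^sup>2"
    and trans: "\<And>\<epsilon>. \<epsilon> \<in> A \<Longrightarrow> transfers \<kappa> \<epsilon> (l \<epsilon>) (s_plus ninf \<epsilon>) \<eta> \<eta>'"
    and extend: "\<And>f c t. f \<in> borel_measurable borel \<Longrightarrow> (\<And>s. n1\<^sup>2 \<le> f s \<and> f s \<le> n2\<^sup>2) \<Longrightarrow> c \<in> C \<Longrightarrow> 0 \<le> t \<Longrightarrow>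
      transfers \<kappa> f c (c + t) \<eta> \<eta>' \<Longrightarrow>
      \<exists>\<epsilon>\<in>A. (AE s\<in>{c<..<c + t} in lebesgue. \<epsilon> s = f s) \<and> c \<le> l \<epsilon> \<and> s_plus ninf \<epsilon> \<le> c + t"
  shows "(INF \<epsilon>\<in>A. ereal (len ninf \<epsilon>)) = ereal m * T_min n1 n2 \<kappa> s0 \<eta> \<eta>'"
    and "(\<lambda>\<epsilon>. restr {l \<epsilon><..<s_plus ninf \<epsilon>} \<epsilon>) ` {\<epsilon>. is_arg_min (len ninf) (\<lambda>\<epsilon>. \<epsilon> \<in> A) \<epsilon>}
      = (\<Union>c\<in>C. translated_controls n1 n2 \<kappa> s0 \<eta> \<eta>' c)"
proof -
  let ?T = "T_min n1 n2 \<kappa> s0 \<eta> \<eta>'"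
  have n_sq: "n1\<^sup>2 \<le> n2\<^sup>2" using n by (intro power_mono) auto
  have to_control: "\<exists>u. feasible_control n1 n2 s0 u \<and> steers \<kappa> u s0 \<eta> \<eta>' (s_plus ninf \<epsilon> - l \<epsilon>) \<and>
      (AE s\<in>{l \<epsilon><..<s_plus ninf \<epsilon>} in lebesgue. u (s - l \<epsilon> + s0) = \<epsilon> s)" if \<epsilon>: "\<epsilon> \<in> A" for \<epsilon>
  proof -
    let ?c = "l \<epsilon>" and ?d = "s_plus ninf \<epsilon>"
    have "Linf_on {?c<..<?d} \<epsilon>"
      using Linf[OF \<epsilon>] unfolding Linf_on_def by (auto intro: measurable_restrict_space1)
    then obtain f where f: "f \<in> borel_measurable borel" "\<And>s. n1\<^sup>2 \<le> f s \<and> f s \<le> n2\<^sup>2"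
      "AE s\<in>{?c<..<?d} in lebesgue. \<epsilon> s = f s"
      using Linf_on_borel_clip[OF _ _ n_sq bounds[OF \<epsilon>]] by auto
    \<comment> \<open>Since \<open>f\<close> is clipped on the whole line, \<open>u\<close> is feasible beyond the interval as well.\<close>
    define u where "u s = f (s + (?c - s0))" for s
    have u: "u \<in> borel_measurable borel" unfolding u_def using f(1) by measurable
    have u_bounds: "n1\<^sup>2 \<le> u s \<and> u s \<le> n2\<^sup>2" for s unfolding u_def using f(2) .
    have "\<bar>u s\<bar> \<le> n2\<^sup>2" for s using u_bounds[of s] order_trans[OF zero_le_power2[of n1], of "u s"] by auto
    then have feas: "feasible_control n1 n2 s0 u"
      using borel_bounded_imp_Linf_on[OF u] u_bounds unfolding feasible_control_def by auto
    have "transfers \<kappa> f ?c ?d \<eta> \<eta>'"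
      using trans[OF \<epsilon>] transfers_AE_cong[OF AE_open_imp_closed_interval[OF f(3)]] by blast
    then have "transfers \<kappa> u s0 (s0 + (?d - ?c)) \<eta> \<eta>'"
      unfolding u_def transfers_shift by simp
    then have "steers \<kappa> u s0 \<eta> \<eta>' (?d - ?c)"
      using steers_iff_transfers[OF borel_bounded_imp_bdd_coeff[OF u u_bounds], of s0 "?d - ?c" u] l[OF \<epsilon>] by simp
    moreover have "AE s\<in>{?c<..<?d} in lebesgue. u (s - ?c + s0) = \<epsilon> s"
      using f(3) by eventually_elim (auto simp: u_def)
    ultimately show ?thesis using feas by blast
  qed
  have to_coeff: "\<exists>\<epsilon>\<in>A. (AE s\<in>{c<..<c + t} in lebesgue. \<epsilon> s = u (s - c + s0)) \<and> c \<le> l \<epsilon> \<and> s_plus ninf \<epsilon> \<le> c + t"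
    if u: "feasible_control n1 n2 s0 u" "steers \<kappa> u s0 \<eta> \<eta>' t" and t: "0 \<le> t" and c: "c \<in> C" for u t c
  proof -
    obtain f where f: "f \<in> borel_measurable borel" "\<And>s. n1\<^sup>2 \<le> f s \<and> f s \<le> n2\<^sup>2"
      "AE s\<in>{s0<..} in lebesgue. u s = f s"
      using Linf_on_borel_clip[of "{s0<..}" u "n1\<^sup>2" "n2\<^sup>2"] u(1) n_sq unfolding feasible_control_def by auto
    have "AE s\<in>{s0..s0 + t} in lebesgue. u s = f s"
      using f(3) AE_lebesgue_neq[of s0] by eventually_elim auto
    from steers_iff_transfers[OF borel_bounded_imp_bdd_coeff[OF f(1,2)] this t] u(2)
    have "transfers \<kappa> f s0 (s0 + t) \<eta> \<eta>'" by simp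
    then have "transfers \<kappa> (\<lambda>s. f (s + (s0 - c))) c (c + t) \<eta> \<eta>'"
      unfolding transfers_shift by (simp add: algebra_simps)
    moreover have "(\<lambda>s. f (s + (s0 - c))) \<in> borel_measurable borel" using f(1) by measurable
    ultimately obtain \<epsilon> where \<epsilon>: "\<epsilon> \<in> A" "AE s\<in>{c<..<c + t} in lebesgue. \<epsilon> s = f (s + (s0 - c))"
      "c \<le> l \<epsilon>" "s_plus ninf \<epsilon> \<le> c + t"
      using extend[of "\<lambda>s. f (s + (s0 - c))" c t] f(2) c t by blast
    have "AE s in lebesgue. s + (s0 - c) \<in> {s0<..} \<longrightarrow> u (s + (s0 - c)) = f (s + (s0 - c))"
      using AE_lebesgue_translate[OF f(3), of "s0 - c"] .
    with \<epsilon>(2) have "AE s\<in>{c<..<c + t} in lebesgue. \<epsilon> s = u (s - c + s0)"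
      by eventually_elim (auto simp: algebra_simps)
    then show ?thesis using \<epsilon> by blast
  qed
  let ?\<T> = "{t. t \<ge> 0 \<and> (\<exists>u. feasible_control n1 n2 s0 u \<and> steers \<kappa> u s0 \<eta> \<eta>' t)}"
  let ?L = "INF \<epsilon>\<in>A. ereal (len ninf \<epsilon>)"
  have T_le: "?T \<le> ereal (s_plus ninf \<epsilon> - l \<epsilon>)" if "\<epsilon> \<in> A" for \<epsilon>
    unfolding T_min_def using to_control[OF that] l[OF that] by (intro INF_lower) auto
  have T0: "0 \<le> ?T" unfolding T_min_def by (intro INF_greatest) simp
  show L: "?L = ereal m * ?T"
  proof (rule antisym)
    show "ereal m * ?T \<le> ?L"
    proof (rule INF_greatest)
      fix \<epsilon> assume \<epsilon>: "\<epsilon> \<in> A"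
      have "ereal m * ?T \<le> ereal m * ereal (s_plus ninf \<epsilon> - l \<epsilon>)"
        using T_le[OF \<epsilon>] m by (intro ereal_mult_left_mono) auto
      then show "ereal m * ?T \<le> ereal (len ninf \<epsilon>)" by (simp add: len[OF \<epsilon>])
    qed
    have "?L / ereal m \<le> ?T"
      unfolding T_min_def
    proof (rule INF_greatest)
      fix t assume "t \<in> ?\<T>"
      then obtain u where u: "feasible_control n1 n2 s0 u" "steers \<kappa> u s0 \<eta> \<eta>' t" "0 \<le> t" by blast
      obtain c where "c \<in> C" using C by blast
      from to_coeff[OF u this] obtain \<epsilon> where \<epsilon>: "\<epsilon> \<in> A" "c \<le> l \<epsilon>" "s_plus ninf \<epsilon> \<le> c + t" by blast
      have "?L \<le> ereal (len ninf \<epsilon>)" using \<epsilon>(1) by (rule INF_lower)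
      also have "len ninf \<epsilon> \<le> m * t" unfolding len[OF \<epsilon>(1)] using \<epsilon> m by (intro mult_left_mono) auto
      finally show "?L / ereal m \<le> ereal t" using m by (simp add: ereal_divide_le_pos)
    qed
    then show "?L \<le> ereal m * ?T" using m by (simp add: ereal_divide_le_pos)
  qed
  show "(\<lambda>\<epsilon>. restr {l \<epsilon><..<s_plus ninf \<epsilon>} \<epsilon>) ` {\<epsilon>. is_arg_min (len ninf) (\<lambda>\<epsilon>. \<epsilon> \<in> A) \<epsilon>}
      = (\<Union>c\<in>C. translated_controls n1 n2 \<kappa> s0 \<eta> \<eta>' c)" (is "?lhs = ?rhs")
  proof (intro equalityI subsetI)
    fix r assume "r \<in> ?lhs"
    then obtain \<epsilon> where r: "r = restr {l \<epsilon><..<s_plus ninf \<epsilon>} \<epsilon>"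
      and \<epsilon>: "\<epsilon> \<in> A" and least: "\<And>\<epsilon>'. \<epsilon>' \<in> A \<Longrightarrow> len ninf \<epsilon> \<le> len ninf \<epsilon>'"
      by (auto simp: is_arg_min_linorder)
    define t where "t = s_plus ninf \<epsilon> - l \<epsilon>"
    have "?L = ereal (len ninf \<epsilon>)"
      using least by (intro antisym INF_lower[OF \<epsilon>] INF_greatest) auto
    then have "ereal m * ?T = ereal m * ereal t" using L len[OF \<epsilon>] by (simp add: t_def)
    then have T: "?T = ereal t" using m by (cases ?T) auto
    obtain u where u: "feasible_control n1 n2 s0 u" "steers \<kappa> u s0 \<eta> \<eta>' t"
      "AE s\<in>{l \<epsilon><..<s_plus ninf \<epsilon>} in lebesgue. u (s - l \<epsilon> + s0) = \<epsilon> s"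
      using to_control[OF \<epsilon>] unfolding t_def by blast
    have "u \<in> min_time_controls n1 n2 \<kappa> s0 \<eta> \<eta>'" unfolding min_time_controls_def using u T by blast
    moreover have "r = restr {l \<epsilon><..<l \<epsilon> + real_of_ereal ?T} (\<lambda>s. u (s - l \<epsilon> + s0))"
      unfolding r T using restr_eqI[OF u(3)] by (simp add: t_def)
    ultimately have "r \<in> translated_controls n1 n2 \<kappa> s0 \<eta> \<eta>' (l \<epsilon>)"
      unfolding translated_controls_def by blast
    then show "r \<in> ?rhs" using l[OF \<epsilon>] by blast
  next
    fix r assume "r \<in> ?rhs"
    then obtain c u where c: "c \<in> C" and u: "u \<in> min_time_controls n1 n2 \<kappa> s0 \<eta> \<eta>'"
      and r: "r = restr {c<..<c + real_of_ereal ?T} (\<lambda>s. u (s - c + s0))"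
      unfolding translated_controls_def by blast
    obtain t where t: "feasible_control n1 n2 s0 u" "?T = ereal t" "steers \<kappa> u s0 \<eta> \<eta>' t"
      using u unfolding min_time_controls_def by blast
    have t0: "0 \<le> t" using T0 t(2) by simp
    obtain \<epsilon> where \<epsilon>: "\<epsilon> \<in> A" "AE s\<in>{c<..<c + t} in lebesgue. \<epsilon> s = u (s - c + s0)"
      "c \<le> l \<epsilon>" "s_plus ninf \<epsilon> \<le> c + t"
      using to_coeff[OF t(1,3) t0 c] by blast
    have least: "m * t \<le> len ninf \<epsilon>'" if "\<epsilon>' \<in> A" for \<epsilon>'
    proof -
      have "ereal (m * t) \<le> ereal (len ninf \<epsilon>')"
        using L INF_lower[OF that, of "\<lambda>\<epsilon>. ereal (len ninf \<epsilon>)"] t(2) by simp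
      then show ?thesis by simp
    qed
    have "t \<le> s_plus ninf \<epsilon> - l \<epsilon>" using least[OF \<epsilon>(1)] m by (simp add: len[OF \<epsilon>(1)])
    then have ends: "l \<epsilon> = c" "s_plus ninf \<epsilon> = c + t" using \<epsilon>(3,4) by auto
    have "is_arg_min (len ninf) (\<lambda>\<epsilon>. \<epsilon> \<in> A) \<epsilon>"
      unfolding is_arg_min_linorder using \<epsilon>(1) least by (auto simp: len[OF \<epsilon>(1)] ends)
    moreover have "r = restr {l \<epsilon><..<s_plus ninf \<epsilon>} \<epsilon>"
      unfolding r ends t(2) using restr_eqI[OF \<epsilon>(2)] by simp
    ultimately show "r \<in> ?lhs" by blast
  qed
qed

section \<open>The three problems\<close>

lemma coeffs_bounds:
  assumes "\<epsilon> \<in> coeffs n1 n2 ninf"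
    and iff: "\<And>a b. const_outside ninf \<epsilon> a b \<longleftrightarrow> a \<le> \<alpha> \<and> \<beta> \<le> b"
  shows "AE s\<in>{\<alpha><..<\<beta>} in lebesgue. n1\<^sup>2 \<le> \<epsilon> s \<and> \<epsilon> s \<le> n2\<^sup>2"
proof -
  obtain a b where ab: "a \<le> \<alpha>" "\<beta> \<le> b" "AE s\<in>{a<..<b} in lebesgue. n1\<^sup>2 \<le> \<epsilon> s \<and> \<epsilon> s \<le> n2\<^sup>2"
    using assms unfolding coeffs_def by auto
  from ab(3) show ?thesis by eventually_elim (use ab(1,2) in auto)
qed

lemma const_outside_if_constant:
  "AE s in lebesgue. \<epsilon> s = ninf\<^sup>2 \<Longrightarrow> a \<le> b \<Longrightarrow> const_outside ninf \<epsilon> a b"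
  unfolding const_outside_def by (auto elim: AE_mp)

lemma coeffs_const_outside:
  "\<epsilon> \<in> coeffs n1 n2 ninf \<Longrightarrow> \<exists>a b. const_outside ninf \<epsilon> a b"
  by (auto simp: coeffs_def)

text \<open>
  A constant coefficient has no resonances: the interval could be shrunk to a point, where the two boundary
  conditions contradict each other. So the shortest interval of a coefficient with a resonance is
  nondegenerate.
\<close>

lemma resonance_endpoints:
  assumes "0 < ninf" "\<kappa> \<in> resonances ninf \<epsilon>" "\<epsilon> \<in> coeffs n1 n2 ninf"
  shows "s_minus ninf \<epsilon> < s_plus ninf \<epsilon>"
    and "\<And>a b. const_outside ninf \<epsilon> a b \<longleftrightarrow> a \<le> s_minus ninf \<epsilon> \<and> s_plus ninf \<epsilon> \<le> b"
proof -
  have \<kappa>: "\<kappa> \<noteq> 0" and Linf: "Linf_on UNIV \<epsilon>" using assms by (auto simp: resonances_def coeffs_def)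
  have "\<not> (AE s in lebesgue. \<epsilon> s = ninf\<^sup>2)"
  proof
    assume "AE s in lebesgue. \<epsilon> s = ninf\<^sup>2"
    then have "const_outside ninf \<epsilon> 0 0" by (simp add: const_outside_if_constant)
    then have "transfers \<kappa> \<epsilon> 0 0 (Some (- of_real ninf)) (Some (of_real ninf))"
      using assms(2) resonance_iff_transfers[OF \<kappa> Linf] by blast
    then show False using assms(1) by (auto simp: transfers_def neg_equal_iff_equal)
  qed
  with coeffs_const_outside[OF assms(3)] show "s_minus ninf \<epsilon> < s_plus ninf \<epsilon>"
    and "\<And>a b. const_outside ninf \<epsilon> a b \<longleftrightarrow> a \<le> s_minus ninf \<epsilon> \<and> s_plus ninf \<epsilon> \<le> b"
    using shortest_interval_least by blast+
qed

lemma bounded_by_squares: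
  assumes "\<And>s. n1\<^sup>2 \<le> f s \<and> f s \<le> (n2::real)\<^sup>2"
  shows "\<bar>if P then f s else ninf\<^sup>2\<bar> \<le> n2\<^sup>2 + ninf\<^sup>2"
proof -
  have "0 \<le> f s" using order_trans[OF zero_le_power2[of n1]] assms[of s] by blast
  then show ?thesis using assms[of s] by (cases P) (simp_all add: add_increasing2 add_increasing)
qed

lemma unrestricted_problem:
  fixes n1 n2 ninf :: real and \<kappa> :: complex
  assumes n: "0 < n1" "n1 < n2" "0 < ninf" and \<kappa>: "\<kappa> \<noteq> 0"
  shows "L_min n1 n2 ninf \<kappa> = T_min n1 n2 \<kappa> s0 (Some (- of_real ninf)) (Some (of_real ninf))"
    and "(\<lambda>\<epsilon>. restr {s_minus ninf \<epsilon><..<s_plus ninf \<epsilon>} \<epsilon>) ` minimizers n1 n2 ninf \<kappa>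
      = (\<Union>c. translated_controls n1 n2 \<kappa> s0 (Some (- of_real ninf)) (Some (of_real ninf)) c)"
proof -
  let ?A = "{\<epsilon> \<in> coeffs n1 n2 ninf. \<kappa> \<in> resonances ninf \<epsilon>}"
  let ?\<eta> = "Some (- of_real ninf)" and ?\<eta>' = "Some (of_real ninf)"
  have ends: "s_minus ninf \<epsilon> < s_plus ninf \<epsilon>"
    "\<And>a b. const_outside ninf \<epsilon> a b \<longleftrightarrow> a \<le> s_minus ninf \<epsilon> \<and> s_plus ninf \<epsilon> \<le> b" if "\<epsilon> \<in> ?A" for \<epsilon>
    using resonance_endpoints[OF n(3)] that by blast+
  have Linf: "Linf_on UNIV \<epsilon>" if "\<epsilon> \<in> ?A" for \<epsilon> using that by (auto simp: coeffs_def)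
  have bounds: "AE s\<in>{s_minus ninf \<epsilon><..<s_plus ninf \<epsilon>} in lebesgue. n1\<^sup>2 \<le> \<epsilon> s \<and> \<epsilon> s \<le> n2\<^sup>2"
    if "\<epsilon> \<in> ?A" for \<epsilon>
    by (rule coeffs_bounds[OF _ ends(2)[OF that]]) (use that in simp)
  have trans: "transfers \<kappa> \<epsilon> (s_minus ninf \<epsilon>) (s_plus ninf \<epsilon>) ?\<eta> ?\<eta>'" if "\<epsilon> \<in> ?A" for \<epsilon>
    using resonance_iff_transfers[OF \<kappa> Linf[OF that], of ninf "s_minus ninf \<epsilon>" "s_plus ninf \<epsilon>"]
      ends(2)[OF that] that by simp
  have extend: "\<exists>\<epsilon>\<in>?A. (AE s\<in>{c<..<c + t} in lebesgue. \<epsilon> s = f s) \<and>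
      c \<le> s_minus ninf \<epsilon> \<and> s_plus ninf \<epsilon> \<le> c + t"
    if f: "f \<in> borel_measurable borel" "\<And>s. n1\<^sup>2 \<le> f s \<and> f s \<le> n2\<^sup>2" and c: "c \<in> UNIV" and t: "0 \<le> t"
      and T: "transfers \<kappa> f c (c + t) ?\<eta> ?\<eta>'" for f c t
  proof -
    define \<epsilon> where "\<epsilon> s = (if s \<in> {c<..<c + t} then f s else ninf\<^sup>2)" for s
    have "\<epsilon> \<in> borel_measurable borel" unfolding \<epsilon>_def using f(1) by measurable
    then have Linf: "Linf_on UNIV \<epsilon>"
      by (rule borel_bounded_imp_Linf_on) (unfold \<epsilon>_def, rule bounded_by_squares[OF f(2)])
    have out: "const_outside ninf \<epsilon> c (c + t)" using t by (auto simp: const_outside_def \<epsilon>_def)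
    have pos: "0 < \<epsilon> s" for s
      using f(2)[of s] n less_le_trans[of 0 "n1\<^sup>2" "f s"] by (auto simp: \<epsilon>_def)
    have in_bounds: "AE s\<in>{c<..<c + t} in lebesgue. n1\<^sup>2 \<le> \<epsilon> s \<and> \<epsilon> s \<le> n2\<^sup>2"
      using f(2) by (simp add: \<epsilon>_def)
    have co: "\<epsilon> \<in> coeffs n1 n2 ninf"
      unfolding coeffs_def mem_Collect_eq using Linf out pos in_bounds by auto
    have eq: "AE s\<in>{c<..<c + t} in lebesgue. \<epsilon> s = f s" by (simp add: \<epsilon>_def)
    have "transfers \<kappa> \<epsilon> c (c + t) ?\<eta> ?\<eta>'"
      using T transfers_AE_cong[OF AE_open_imp_closed_interval[OF eq]] by blast
    then have "\<epsilon> \<in> ?A" using co resonance_iff_transfers[OF \<kappa> Linf out] by blast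
    then show ?thesis using eq ends(2)[of \<epsilon>] out by blast
  qed
  have l: "s_minus ninf \<epsilon> \<in> UNIV \<and> s_minus ninf \<epsilon> \<le> s_plus ninf \<epsilon>" if "\<epsilon> \<in> ?A" for \<epsilon>
    using ends(1)[OF that] by simp
  have len: "len ninf \<epsilon> = 1 * (s_plus ninf \<epsilon> - s_minus ninf \<epsilon>)" if "\<epsilon> \<in> ?A" for \<epsilon>
    by (simp add: len_def)
  have 1: "(INF \<epsilon>\<in>?A. ereal (len ninf \<epsilon>)) = ereal 1 * T_min n1 n2 \<kappa> s0 ?\<eta> ?\<eta>'"
    by (rule min_time_problem_equivalence(1)[where l = "s_minus ninf" and C = UNIV])
      (fact n(1), fact n(2), simp, simp, fact Linf, fact l, fact len, fact bounds, fact trans, fact extend)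
  have 2: "(\<lambda>\<epsilon>. restr {s_minus ninf \<epsilon><..<s_plus ninf \<epsilon>} \<epsilon>) ` {\<epsilon>. is_arg_min (len ninf) (\<lambda>\<epsilon>. \<epsilon> \<in> ?A) \<epsilon>}
      = (\<Union>c\<in>UNIV. translated_controls n1 n2 \<kappa> s0 ?\<eta> ?\<eta>' c)"
    by (rule min_time_problem_equivalence(2)[where l = "s_minus ninf" and C = UNIV and m = 1])
      (fact n(1), fact n(2), simp, simp, fact Linf, fact l, fact len, fact bounds, fact trans, fact extend)
  show "L_min n1 n2 ninf \<kappa> = T_min n1 n2 \<kappa> s0 ?\<eta> ?\<eta>'"
    using 1 unfolding L_min_def by (simp flip: one_ereal_def)
  show "(\<lambda>\<epsilon>. restr {s_minus ninf \<epsilon><..<s_plus ninf \<epsilon>} \<epsilon>) ` minimizers n1 n2 ninf \<kappa>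
      = (\<Union>c. translated_controls n1 n2 \<kappa> s0 ?\<eta> ?\<eta>' c)"
    using 2 unfolding minimizers_def mem_Collect_eq .
qed

text \<open>
  \<open>R \<epsilon>\<close> stands for the odd or the even resonances. A control on \<open>(0, t)\<close> is extended
  evenly to \<open>(- t, t)\<close>, and the shortest interval of a symmetric coefficient is symmetric, so its length is
  twice the duration of the control.
\<close>

lemma symmetric_problem:
  fixes n1 n2 ninf :: real and \<kappa> :: complex and R :: "(real \<Rightarrow> real) \<Rightarrow> complex set"
  assumes n: "0 < n1" "n1 < n2" "0 < ninf" and \<eta>: "\<eta> = None \<or> \<eta> = Some 0"
    and R: "\<And>\<epsilon> b. Linf_on UNIV \<epsilon> \<Longrightarrow> AE s in lebesgue. \<epsilon> s = \<epsilon> (- s) \<Longrightarrow> const_outside ninf \<epsilon> (- b) b \<Longrightarrow>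
      \<kappa> \<in> R \<epsilon> \<longleftrightarrow> transfers \<kappa> \<epsilon> 0 b \<eta> (Some (of_real ninf))"
  shows "(INF \<epsilon> \<in> {\<epsilon> \<in> coeffs_sym n1 n2 ninf. \<kappa> \<in> R \<epsilon>}. ereal (len ninf \<epsilon>))
      = 2 * T_min n1 n2 \<kappa> s0 \<eta> (Some (of_real ninf))"
    and "(\<lambda>\<epsilon>. restr {0<..<s_plus ninf \<epsilon>} \<epsilon>) `
        {\<epsilon>. is_arg_min (len ninf) (\<lambda>\<epsilon>. \<epsilon> \<in> coeffs_sym n1 n2 ninf \<and> \<kappa> \<in> R \<epsilon>) \<epsilon>}
      = translated_controls n1 n2 \<kappa> s0 \<eta> (Some (of_real ninf)) 0"
proof -
  let ?A = "{\<epsilon> \<in> coeffs_sym n1 n2 ninf. \<kappa> \<in> R \<epsilon>}"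
  let ?\<eta>' = "Some (complex_of_real ninf)"
  have Linf: "Linf_on UNIV \<epsilon>" and sym: "AE s in lebesgue. \<epsilon> s = \<epsilon> (- s)"
    and co: "\<epsilon> \<in> coeffs n1 n2 ninf" if "\<epsilon> \<in> ?A" for \<epsilon>
    using that by (auto simp: coeffs_sym_def coeffs_def)
  have ends: "s_minus ninf \<epsilon> = - s_plus ninf \<epsilon> \<and> 0 < s_plus ninf \<epsilon> \<and>
    (\<forall>a b. const_outside ninf \<epsilon> a b \<longleftrightarrow> a \<le> s_minus ninf \<epsilon> \<and> s_plus ninf \<epsilon> \<le> b)" if A: "\<epsilon> \<in> ?A" for \<epsilon>
  proof -
    have "\<not> (AE s in lebesgue. \<epsilon> s = ninf\<^sup>2)"
    proof
      assume "AE s in lebesgue. \<epsilon> s = ninf\<^sup>2"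
      then have "const_outside ninf \<epsilon> (- 0) 0" by (simp add: const_outside_if_constant)
      then have "transfers \<kappa> \<epsilon> 0 0 \<eta> ?\<eta>'" using R[OF Linf[OF A] sym[OF A], of 0] A by simp
      then show False using n(3) \<eta> by (auto simp: transfers_def)
    qed
    then have *: "s_minus ninf \<epsilon> < s_plus ninf \<epsilon>"
      "\<And>a b. const_outside ninf \<epsilon> a b \<longleftrightarrow> a \<le> s_minus ninf \<epsilon> \<and> s_plus ninf \<epsilon> \<le> b"
      using shortest_interval_least coeffs_const_outside[OF co[OF A]] by blast+
    have "AE s\<in>- {s_minus ninf \<epsilon>..s_plus ninf \<epsilon>} in lebesgue. \<epsilon> s = ninf\<^sup>2"
      using *(2)[of "s_minus ninf \<epsilon>" "s_plus ninf \<epsilon>"] by (simp add: const_outside_def)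
    from AE_lebesgue_reflect[OF this] sym[OF A]
    have "AE s\<in>- {- s_plus ninf \<epsilon>..- s_minus ninf \<epsilon>} in lebesgue. \<epsilon> s = ninf\<^sup>2"
      by eventually_elim auto
    then have "const_outside ninf \<epsilon> (- s_plus ninf \<epsilon>) (- s_minus ninf \<epsilon>)"
      using *(1) by (simp add: const_outside_def)
    then have "s_minus ninf \<epsilon> = - s_plus ninf \<epsilon>" unfolding *(2) by auto
    then show ?thesis using * by auto
  qed
  have bounds: "AE s\<in>{0<..<s_plus ninf \<epsilon>} in lebesgue. n1\<^sup>2 \<le> \<epsilon> s \<and> \<epsilon> s \<le> n2\<^sup>2"
    if "\<epsilon> \<in> ?A" for \<epsilon>
  proof -
    have "AE s\<in>{s_minus ninf \<epsilon><..<s_plus ninf \<epsilon>} in lebesgue. n1\<^sup>2 \<le> \<epsilon> s \<and> \<epsilon> s \<le> n2\<^sup>2"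
      using ends[OF that] by (intro coeffs_bounds[OF co[OF that]]) auto
    then show ?thesis by eventually_elim (use ends[OF that] in auto)
  qed
  have trans: "transfers \<kappa> \<epsilon> 0 (s_plus ninf \<epsilon>) \<eta> ?\<eta>'" if "\<epsilon> \<in> ?A" for \<epsilon>
    using R[OF Linf[OF that] sym[OF that], of "s_plus ninf \<epsilon>"] ends[OF that] that by simp
  have extend: "\<exists>\<epsilon>\<in>?A. (AE s\<in>{c<..<c + t} in lebesgue. \<epsilon> s = f s) \<and> c \<le> 0 \<and> s_plus ninf \<epsilon> \<le> c + t"
    if f: "f \<in> borel_measurable borel" "\<And>s. n1\<^sup>2 \<le> f s \<and> f s \<le> n2\<^sup>2" and c: "c \<in> {0}" and t: "0 \<le> t"
      and T: "transfers \<kappa> f c (c + t) \<eta> ?\<eta>'" for f c t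
  proof -
    define \<epsilon> where "\<epsilon> s = (if s \<in> {- t<..<t} then f \<bar>s\<bar> else ninf\<^sup>2)" for s
    have "\<epsilon> \<in> borel_measurable borel" unfolding \<epsilon>_def using f(1) by measurable
    then have Linf': "Linf_on UNIV \<epsilon>"
      by (rule borel_bounded_imp_Linf_on) (unfold \<epsilon>_def, rule bounded_by_squares[OF f(2)])
    have out: "const_outside ninf \<epsilon> (- t) t" using t by (auto simp: const_outside_def \<epsilon>_def)
    have in_bounds: "AE s\<in>{- t<..<t} in lebesgue. n1\<^sup>2 \<le> \<epsilon> s \<and> \<epsilon> s \<le> n2\<^sup>2"
      using f(2) by (simp add: \<epsilon>_def)
    have pos: "0 < \<epsilon> s" for s
      using f(2)[of "\<bar>s\<bar>"] n less_le_trans[of 0 "n1\<^sup>2" "f \<bar>s\<bar>"] by (auto simp: \<epsilon>_def)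
    have "\<epsilon> \<in> coeffs n1 n2 ninf"
      unfolding coeffs_def mem_Collect_eq using Linf' out pos in_bounds by auto
    moreover have sym': "AE s in lebesgue. \<epsilon> s = \<epsilon> (- s)" by (auto simp: \<epsilon>_def)
    ultimately have cs: "\<epsilon> \<in> coeffs_sym n1 n2 ninf" by (simp add: coeffs_sym_def)
    have eq: "AE s\<in>{0<..<t} in lebesgue. \<epsilon> s = f s" by (auto simp: \<epsilon>_def)
    have "transfers \<kappa> \<epsilon> 0 t \<eta> ?\<eta>'"
      using T c transfers_AE_cong[OF AE_open_imp_closed_interval[OF eq]] by simp
    then have A: "\<epsilon> \<in> ?A" using cs R[OF Linf' sym' out] by blast
    moreover have "s_plus ninf \<epsilon> \<le> t" using ends[OF A] out by blast
    ultimately show ?thesis using eq c by auto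
  qed
  have l: "0 \<in> {0} \<and> 0 \<le> s_plus ninf \<epsilon>" if "\<epsilon> \<in> ?A" for \<epsilon>
    using ends[OF that] by simp
  have len: "len ninf \<epsilon> = 2 * (s_plus ninf \<epsilon> - 0)" if "\<epsilon> \<in> ?A" for \<epsilon>
    using ends[OF that] by (simp add: len_def)
  have "(INF \<epsilon>\<in>?A. ereal (len ninf \<epsilon>)) = ereal 2 * T_min n1 n2 \<kappa> s0 \<eta> ?\<eta>'"
    by (rule min_time_problem_equivalence(1)[where l = "\<lambda>_. 0" and C = "{0}"])
      (fact n(1), fact n(2), simp, simp, fact Linf, fact l, fact len, fact bounds, fact trans, fact extend)
  then show "(INF \<epsilon> \<in> ?A. ereal (len ninf \<epsilon>)) = 2 * T_min n1 n2 \<kappa> s0 \<eta> ?\<eta>'" by simp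
  have 2: "(\<lambda>\<epsilon>. restr {0<..<s_plus ninf \<epsilon>} \<epsilon>) ` {\<epsilon>. is_arg_min (len ninf) (\<lambda>\<epsilon>. \<epsilon> \<in> ?A) \<epsilon>}
      = (\<Union>c\<in>{0}. translated_controls n1 n2 \<kappa> s0 \<eta> ?\<eta>' c)"
    by (rule min_time_problem_equivalence(2)[where l = "\<lambda>_. 0" and C = "{0}" and m = 2])
      (fact n(1), fact n(2), simp, simp, fact Linf, fact l, fact len, fact bounds, fact trans, fact extend)
  show "(\<lambda>\<epsilon>. restr {0<..<s_plus ninf \<epsilon>} \<epsilon>) `
        {\<epsilon>. is_arg_min (len ninf) (\<lambda>\<epsilon>. \<epsilon> \<in> coeffs_sym n1 n2 ninf \<and> \<kappa> \<in> R \<epsilon>) \<epsilon>}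
      = translated_controls n1 n2 \<kappa> s0 \<eta> ?\<eta>' 0"
    using 2 unfolding mem_Collect_eq by simp
qed

theorem proposition3p1:
  fixes n1 n2 ninf :: real and \<kappa> :: complex and s0 :: real
  assumes "0 < n1" and "n1 < n2" and "0 < ninf" and "\<kappa> \<noteq> 0"
  shows
    "(L_min n1 n2 ninf \<kappa> = T_min n1 n2 \<kappa> s0 (Some (- of_real ninf)) (Some (of_real ninf)) \<and>
      (\<lambda>\<epsilon>. restr {s_minus ninf \<epsilon><..<s_plus ninf \<epsilon>} \<epsilon>) ` minimizers n1 n2 ninf \<kappa>
        = (\<Union>c. translated_controls n1 n2 \<kappa> s0 (Some (- of_real ninf)) (Some (of_real ninf)) c)) \<and>
     (L_min_odd n1 n2 ninf \<kappa> = 2 * T_min n1 n2 \<kappa> s0 None (Some (of_real ninf)) \<and>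
      (\<lambda>\<epsilon>. restr {0<..<s_plus ninf \<epsilon>} \<epsilon>) ` minimizers_odd n1 n2 ninf \<kappa>
        = translated_controls n1 n2 \<kappa> s0 None (Some (of_real ninf)) 0) \<and>
     (L_min_even n1 n2 ninf \<kappa> = 2 * T_min n1 n2 \<kappa> s0 (Some 0) (Some (of_real ninf)) \<and>
      (\<lambda>\<epsilon>. restr {0<..<s_plus ninf \<epsilon>} \<epsilon>) ` minimizers_even n1 n2 ninf \<kappa>
        = translated_controls n1 n2 \<kappa> s0 (Some 0) (Some (of_real ninf)) 0)"
proof (intro conjI)
  show "L_min n1 n2 ninf \<kappa> = T_min n1 n2 \<kappa> s0 (Some (- of_real ninf)) (Some (of_real ninf))"
    and "(\<lambda>\<epsilon>. restr {s_minus ninf \<epsilon><..<s_plus ninf \<epsilon>} \<epsilon>) ` minimizers n1 n2 ninf \<kappa>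
        = (\<Union>c. translated_controls n1 n2 \<kappa> s0 (Some (- of_real ninf)) (Some (of_real ninf)) c)"
    by (rule unrestricted_problem[OF assms])+
  show "L_min_odd n1 n2 ninf \<kappa> = 2 * T_min n1 n2 \<kappa> s0 None (Some (of_real ninf))"
    and "(\<lambda>\<epsilon>. restr {0<..<s_plus ninf \<epsilon>} \<epsilon>) ` minimizers_odd n1 n2 ninf \<kappa>
        = translated_controls n1 n2 \<kappa> s0 None (Some (of_real ninf)) 0"
    unfolding L_min_odd_def minimizers_odd_def
    by (rule symmetric_problem[OF assms(1-3) _ resonance_odd_iff_transfers[OF assms(4)]]; simp)+
  show "L_min_even n1 n2 ninf \<kappa> = 2 * T_min n1 n2 \<kappa> s0 (Some 0) (Some (of_real ninf))"
    and "(\<lambda>\<epsilon>. restr {0<..<s_plus ninf \<epsilon>} \<epsilon>) ` minimizers_even n1 n2 ninf \<kappa>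
        = translated_controls n1 n2 \<kappa> s0 (Some 0) (Some (of_real ninf)) 0"
    unfolding L_min_even_def minimizers_even_def
    by (rule symmetric_problem[OF assms(1-3) _ resonance_even_iff_transfers[OF assms(4)]]; simp)+
qed

end
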